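(* Let $P_1,P_2$ be non-commutative Poisson algebras over $K$ of the same class (both of Class 1 or both of Class 2), with degree maps $u_i:P_i\to\mathbb Z_{\ge0}\cup\{-\infty\}$ ($i=1,2$) whose induced filtrations are finite and discrete. Let $z_1\in P_1$, $z_2\in P_2$ and $\Gamma=z_1\otimes1+1\otimes z_2\in P_1\otimes P_2$. If $F(z_1)=N(z_1)$ and $F(z_2)=N(z_2)$, then $$F(\Gamma)=N(\Gamma)=N(z_1)\otimes N(z_2),\qquad D(\Gamma)=C(\Gamma),\qquad Ev(\Gamma)=\{0\}.$$ Moreover, if $C(z_1)\subsetneq N(z_1)$ or $C(z_2)\subsetneq N(z_2)$, then $$D(\Gamma)=C(\Gamma)\subsetneq N(\Gamma)=F(\Gamma),$$ and in this case $\Gamma\in\Omega_1(P_1\otimes P_2)\cup\Omega_1'(P_1\otimes P_2)$, i.e. $\Gamma$ is a nilpotent element.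
   Context: $K$ is an algebraically closed field of characteristic zero; tensor products are over $K$. A non-commutative Poisson algebra over $K$ is a $K$-vector space $P$ with a bilinear product $\cdot$ making it a unital associative (not necessarily commutative) $K$-algebra and a bilinear bracket $\{\cdot,\cdot\}$ making it a Lie algebra, such that $\{x,yz\}=\{x,y\}z+y\{x,z\}$ for all $x,y,z\in P$. It is of Class 1 if $(P,\cdot)$ is commutative, and of Class 2 if $(P,\cdot)$ is non-commutative and $\{a,b\}=ab-ba$ for all $a,b$. Tensor product: if $P_1,P_2$ are both of Class 1, $P_1\otimes P_2$ carries the bracket $\{a_1\otimes a_2,b_1\otimes b_2\}=\{a_1,b_1\}\otimes a_2b_2+b_1a_1\otimes\{a_2,b_2\}$; if both are of Class 2, the bracket on $P_1\otimes P_2$ is the commutator. This makes $P_1\otimes P_2$ a non-commutative Poisson algebra of the same class. A degree map on $P$ is a map $u:P\to\mathbb Z\cup\{-\infty\}$ such that for all $z,w\in P$: $u(\{z,w\})\le u(zw)=u(z)+u(w)$; $u(z+w)\le\max\{u(z),u(w)\}$; $u(z)=-\infty$ iff $z=0$. Its induced filtration is $P_t=\{a\in P\mid u(a)\le t\}$, $t\in\mathbb Z$; it is finite if every $P_t$ is finite dimensional over $K$ and discrete if $P_t=\{0\}$ for all $t<0$. For an element $z$ of a non-commutative Poisson algebra $P$ put $ad_z(w)=\{z,w\}$ and $Ev(z)=\{\lambda\in K\mid \exists x\in P\setminus\{0\},\ ad_z(x)=\lambda x\}$, $F(z)=\{x\in P\mid \dim_K K[ad_z](x)<\infty\}$, $N(z)=\{x\in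 P\mid \exists m,\ ad_z^m(x)=0\}$, $C(z)=\{x\in P\mid ad_z(x)=0\}$, $D(z)=\bigoplus_{\lambda\in Ev(z)}\{x\in P\mid ad_z(x)=\lambda x\}$. For $z_i$ these are formed in $P_i$; for $\Gamma$ in $P_1\otimes P_2$. For $z$ with $Ev(z)=\{0\}$: $z\in\Omega_1(P)$ if $C(z)\subsetneq N(z)=P$; $z\in\Omega_1'(P)$ if $C(z)\subsetneq N(z)\subsetneq P$. Elements of $\Omega_1(P)\cup\Omega_1'(P)$ are called nilpotent. *)

theory Defs
  imports
    "HOL-Algebra.Algebraic_Closure"
    "HOL-Algebra.Free_Abelian_Groups"
    "HOL-Library.Extended"
    "Jordan_Normal_Form.Missing_VectorSpace"
begin

section \<open>Non-commutative Poisson algebras\<close>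

record ('k, 'a) poisson = "('k, 'a) module" +
  bracket :: "'a \<Rightarrow> 'a \<Rightarrow> 'a"  (\<open>\<lbrace>_,/ _\<rbrace>\<index>\<close>)

text \<open>
  The algebra is unital with \<open>\<one> \<noteq> \<zero>\<close>, as usual; for the zero algebra no endomorphism has an
  eigenvalue, so that \<open>Ev(z) = {0}\<close> could never hold.
\<close>

locale nc_poisson_algebra = vectorspace K P + alg?: ring P
  for K :: "('k, 'm) ring_scheme" and P :: "('k, 'a, 'n) poisson_scheme" (structure) +
  assumes P_one_not_zero: "\<one> \<noteq> \<zero>"
    and smult_mult_left: "\<lbrakk>c \<in> carrier K; x \<in> carrier P; y \<in> carrier P\<rbrakk>
          \<Longrightarrow> (c \<odot> x) \<otimes> y = c \<odot> (x \<otimes> y)"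
    and smult_mult_right: "\<lbrakk>c \<in> carrier K; x \<in> carrier P; y \<in> carrier P\<rbrakk>
          \<Longrightarrow> x \<otimes> (c \<odot> y) = c \<odot> (x \<otimes> y)"
    and bracket_closed: "\<lbrakk>x \<in> carrier P; y \<in> carrier P\<rbrakk> \<Longrightarrow> \<lbrace>x, y\<rbrace> \<in> carrier P"
    and bracket_add_left: "\<lbrakk>x \<in> carrier P; y \<in> carrier P; w \<in> carrier P\<rbrakk>
          \<Longrightarrow> \<lbrace>x \<oplus> y, w\<rbrace> = \<lbrace>x, w\<rbrace> \<oplus> \<lbrace>y, w\<rbrace>"
    and bracket_add_right: "\<lbrakk>x \<in> carrier P; y \<in> carrier P; w \<in> carrier P\<rbrakk>
          \<Longrightarrow> \<lbrace>w, x \<oplus> y\<rbrace> = \<lbrace>w, x\<rbrace> \<oplus> \<lbrace>w, y\<rbrace>"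
    and bracket_smult_left: "\<lbrakk>c \<in> carrier K; x \<in> carrier P; y \<in> carrier P\<rbrakk>
          \<Longrightarrow> \<lbrace>c \<odot> x, y\<rbrace> = c \<odot> \<lbrace>x, y\<rbrace>"
    and bracket_smult_right: "\<lbrakk>c \<in> carrier K; x \<in> carrier P; y \<in> carrier P\<rbrakk>
          \<Longrightarrow> \<lbrace>x, c \<odot> y\<rbrace> = c \<odot> \<lbrace>x, y\<rbrace>"
    and bracket_self: "x \<in> carrier P \<Longrightarrow> \<lbrace>x, x\<rbrace> = \<zero>"
    and jacobi: "\<lbrakk>x \<in> carrier P; y \<in> carrier P; w \<in> carrier P\<rbrakk>
          \<Longrightarrow> \<lbrace>x, \<lbrace>y, w\<rbrace>\<rbrace> \<oplus> \<lbrace>y, \<lbrace>w, x\<rbrace>\<rbrace> \<oplus> \<lbrace>w, \<lbrace>x, y\<rbrace>\<rbrace> = \<zero>"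
    and leibniz: "\<lbrakk>x \<in> carrier P; y \<in> carrier P; w \<in> carrier P\<rbrakk>
          \<Longrightarrow> \<lbrace>x, y \<otimes> w\<rbrace> = \<lbrace>x, y\<rbrace> \<otimes> w \<oplus> y \<otimes> \<lbrace>x, w\<rbrace>"

definition class1 :: "('k, 'a, 'n) poisson_scheme \<Rightarrow> bool" where
  "class1 P \<longleftrightarrow> (\<forall>a\<in>carrier P. \<forall>b\<in>carrier P. a \<otimes>\<^bsub>P\<^esub> b = b \<otimes>\<^bsub>P\<^esub> a)"

definition class2 :: "('k, 'a, 'n) poisson_scheme \<Rightarrow> bool" where
  "class2 P \<longleftrightarrow> \<not> (\<forall>a\<in>carrier P. \<forall>b\<in>carrier P. a \<otimes>\<^bsub>P\<^esub> b = b \<otimes>\<^bsub>P\<^esub> a) \<and>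
     (\<forall>a\<in>carrier P. \<forall>b\<in>carrier P. \<lbrace>a, b\<rbrace>\<^bsub>P\<^esub> = a \<otimes>\<^bsub>P\<^esub> b \<ominus>\<^bsub>P\<^esub> b \<otimes>\<^bsub>P\<^esub> a)"


section \<open>Tensor products\<close>

text \<open>
  The tensor product is the free abelian group on \<open>P1 \<times> P2\<close> modulo the subgroup generated by
  the usual relators; a class is a coset, i.e.\ a set of formal sums.
\<close>

definition tensor_relators ::
  "('k, 'm) ring_scheme \<Rightarrow> ('k, 'a, 'n1) poisson_scheme \<Rightarrow> ('k, 'b, 'n2) poisson_scheme
    \<Rightarrow> (('a \<times> 'b) \<Rightarrow>\<^sub>0 int) set" where
  "tensor_relators K P1 P2 =
     {frag_of (a \<oplus>\<^bsub>P1\<^esub> a', b) - frag_of (a, b) - frag_of (a', b) | a a' b.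
        a \<in> carrier P1 \<and> a' \<in> carrier P1 \<and> b \<in> carrier P2} \<union>
     {frag_of (a, b \<oplus>\<^bsub>P2\<^esub> b') - frag_of (a, b) - frag_of (a, b') | a b b'.
        a \<in> carrier P1 \<and> b \<in> carrier P2 \<and> b' \<in> carrier P2} \<union>
     {frag_of (c \<odot>\<^bsub>P1\<^esub> a, b) - frag_of (a, c \<odot>\<^bsub>P2\<^esub> b) | c a b.
        c \<in> carrier K \<and> a \<in> carrier P1 \<and> b \<in> carrier P2}"

definition formal_sums ::
  "('k, 'a, 'n1) poisson_scheme \<Rightarrow> ('k, 'b, 'n2) poisson_scheme \<Rightarrow> (('a \<times> 'b) \<Rightarrow>\<^sub>0 int) monoid" where
  "formal_sums P1 P2 = free_Abelian_group (carrier P1 \<times> carrier P2)"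

definition tensor_null ::
  "('k, 'm) ring_scheme \<Rightarrow> ('k, 'a, 'n1) poisson_scheme \<Rightarrow> ('k, 'b, 'n2) poisson_scheme
    \<Rightarrow> (('a \<times> 'b) \<Rightarrow>\<^sub>0 int) set" where
  "tensor_null K P1 P2 = generate (formal_sums P1 P2) (tensor_relators K P1 P2)"

definition tensor_class ::
  "('k, 'm) ring_scheme \<Rightarrow> ('k, 'a, 'n1) poisson_scheme \<Rightarrow> ('k, 'b, 'n2) poisson_scheme
    \<Rightarrow> (('a \<times> 'b) \<Rightarrow>\<^sub>0 int) \<Rightarrow> (('a \<times> 'b) \<Rightarrow>\<^sub>0 int) set" where
  "tensor_class K P1 P2 f = tensor_null K P1 P2 #>\<^bsub>formal_sums P1 P2\<^esub> f"

definition pure_tensor ::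
  "('k, 'm) ring_scheme \<Rightarrow> ('k, 'a, 'n1) poisson_scheme \<Rightarrow> ('k, 'b, 'n2) poisson_scheme
    \<Rightarrow> 'a \<Rightarrow> 'b \<Rightarrow> (('a \<times> 'b) \<Rightarrow>\<^sub>0 int) set" where
  "pure_tensor K P1 P2 a b = tensor_class K P1 P2 (frag_of (a, b))"

definition frag_smult ::
  "('k, 'a, 'n1) poisson_scheme \<Rightarrow> 'k \<Rightarrow> (('a \<times> 'b) \<Rightarrow>\<^sub>0 int) \<Rightarrow> (('a \<times> 'b) \<Rightarrow>\<^sub>0 int)" where
  "frag_smult P1 c = frag_extend (\<lambda>(a, b). frag_of (c \<odot>\<^bsub>P1\<^esub> a, b))"

definition frag_extend2 ::
  "('p \<Rightarrow> 'p \<Rightarrow> ('p \<Rightarrow>\<^sub>0 int)) \<Rightarrow> ('p \<Rightarrow>\<^sub>0 int) \<Rightarrow> ('p \<Rightarrow>\<^sub>0 int) \<Rightarrow> ('p \<Rightarrow>\<^sub>0 int)" where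
  "frag_extend2 h f g = frag_extend (\<lambda>p. frag_extend (\<lambda>q. h p q) g) f"

definition frag_mult ::
  "('k, 'a, 'n1) poisson_scheme \<Rightarrow> ('k, 'b, 'n2) poisson_scheme
    \<Rightarrow> (('a \<times> 'b) \<Rightarrow>\<^sub>0 int) \<Rightarrow> (('a \<times> 'b) \<Rightarrow>\<^sub>0 int) \<Rightarrow> (('a \<times> 'b) \<Rightarrow>\<^sub>0 int)" where
  "frag_mult P1 P2 = frag_extend2 (\<lambda>(a1, a2) (b1, b2). frag_of (a1 \<otimes>\<^bsub>P1\<^esub> b1, a2 \<otimes>\<^bsub>P2\<^esub> b2))"

text \<open>
  The bracket depends on the common class of the factors: the Leibniz-type formula when both
  are of Class 1, the commutator otherwise (only used when both are of Class 2).
\<close>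

definition frag_bracket ::
  "('k, 'a, 'n1) poisson_scheme \<Rightarrow> ('k, 'b, 'n2) poisson_scheme
    \<Rightarrow> (('a \<times> 'b) \<Rightarrow>\<^sub>0 int) \<Rightarrow> (('a \<times> 'b) \<Rightarrow>\<^sub>0 int) \<Rightarrow> (('a \<times> 'b) \<Rightarrow>\<^sub>0 int)" where
  "frag_bracket P1 P2 f g =
     (if class1 P1 \<and> class1 P2
      then frag_extend2 (\<lambda>(a1, a2) (b1, b2).
             frag_of (\<lbrace>a1, b1\<rbrace>\<^bsub>P1\<^esub>, a2 \<otimes>\<^bsub>P2\<^esub> b2) + frag_of (b1 \<otimes>\<^bsub>P1\<^esub> a1, \<lbrace>a2, b2\<rbrace>\<^bsub>P2\<^esub>)) f g
      else frag_mult P1 P2 f g - frag_mult P1 P2 g f)"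

text \<open>
  Operations on classes are induced from representatives, in the style of
  \<^const>\<open>rcoset_mult\<close>: all the cosets in the unions below coincide.
\<close>

definition tensor_poisson ::
  "('k, 'm) ring_scheme \<Rightarrow> ('k, 'a, 'n1) poisson_scheme \<Rightarrow> ('k, 'b, 'n2) poisson_scheme
    \<Rightarrow> ('k, (('a \<times> 'b) \<Rightarrow>\<^sub>0 int) set) poisson" where
  "tensor_poisson K P1 P2 =
    \<lparr> carrier = carrier (formal_sums P1 P2 Mod tensor_null K P1 P2),
      monoid.mult = (\<lambda>A B. \<Union>f\<in>A. \<Union>g\<in>B. tensor_class K P1 P2 (frag_mult P1 P2 f g)),
      one = pure_tensor K P1 P2 \<one>\<^bsub>P1\<^esub> \<one>\<^bsub>P2\<^esub>,
      ring.zero = \<one>\<^bsub>formal_sums P1 P2 Mod tensor_null K P1 P2\<^esub>,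
      add = (\<lambda>A B. A \<otimes>\<^bsub>formal_sums P1 P2 Mod tensor_null K P1 P2\<^esub> B),
      smult = (\<lambda>c A. \<Union>f\<in>A. tensor_class K P1 P2 (frag_smult P1 c f)),
      bracket = (\<lambda>A B. \<Union>f\<in>A. \<Union>g\<in>B. tensor_class K P1 P2 (frag_bracket P1 P2 f g)) \<rparr>"

text \<open>The image of \<open>U \<otimes> V\<close> in \<open>P1 \<otimes> P2\<close>, for subspaces \<open>U\<close> and \<open>V\<close>.\<close>

definition tensor_subspaces ::
  "('k, 'm) ring_scheme \<Rightarrow> ('k, 'a, 'n1) poisson_scheme \<Rightarrow> ('k, 'b, 'n2) poisson_scheme
    \<Rightarrow> 'a set \<Rightarrow> 'b set \<Rightarrow> (('a \<times> 'b) \<Rightarrow>\<^sub>0 int) set set" where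
  "tensor_subspaces K P1 P2 U V =
     module.span K (tensor_poisson K P1 P2) {pure_tensor K P1 P2 x y | x y. x \<in> U \<and> y \<in> V}"


section \<open>Degree maps\<close>

text \<open>Values in \<open>\<int> \<union> {-\<infinity>}\<close>, represented as extended integers other than \<open>\<infinity>\<close>.\<close>

definition degree_map :: "('k, 'a, 'n) poisson_scheme \<Rightarrow> ('a \<Rightarrow> int extended) \<Rightarrow> bool" where
  "degree_map P u \<longleftrightarrow>
     (\<forall>z\<in>carrier P. u z \<noteq> \<infinity>) \<and>
     (\<forall>z\<in>carrier P. \<forall>w\<in>carrier P. u \<lbrace>z, w\<rbrace>\<^bsub>P\<^esub> \<le> u (z \<otimes>\<^bsub>P\<^esub> w)) \<and>
     (\<forall>z\<in>carrier P. \<forall>w\<in>carrier P. u (z \<otimes>\<^bsub>P\<^esub> w) = u z + u w) \<and>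
     (\<forall>z\<in>carrier P. \<forall>w\<in>carrier P. u (z \<oplus>\<^bsub>P\<^esub> w) \<le> max (u z) (u w)) \<and>
     (\<forall>z\<in>carrier P. u z = -\<infinity> \<longleftrightarrow> z = \<zero>\<^bsub>P\<^esub>)"

definition filtration :: "('k, 'a, 'n) poisson_scheme \<Rightarrow> ('a \<Rightarrow> int extended) \<Rightarrow> int \<Rightarrow> 'a set" where
  "filtration P u t = {a \<in> carrier P. u a \<le> Fin t}"

definition fin_dim_subspace ::
  "('k, 'm) ring_scheme \<Rightarrow> ('k, 'a, 'n) poisson_scheme \<Rightarrow> 'a set \<Rightarrow> bool" where
  "fin_dim_subspace K P U \<longleftrightarrow> vectorspace.fin_dim K (P\<lparr>carrier := U\<rparr>)"

definition finite_filtration ::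
  "('k, 'm) ring_scheme \<Rightarrow> ('k, 'a, 'n) poisson_scheme \<Rightarrow> ('a \<Rightarrow> int extended) \<Rightarrow> bool" where
  "finite_filtration K P u \<longleftrightarrow> (\<forall>t. fin_dim_subspace K P (filtration P u t))"

definition discrete_filtration ::
  "('k, 'a, 'n) poisson_scheme \<Rightarrow> ('a \<Rightarrow> int extended) \<Rightarrow> bool" where
  "discrete_filtration P u \<longleftrightarrow> (\<forall>t<0. filtration P u t = {\<zero>\<^bsub>P\<^esub>})"


section \<open>Subspaces attached to an element\<close>

definition ad :: "('k, 'a, 'n) poisson_scheme \<Rightarrow> 'a \<Rightarrow> 'a \<Rightarrow> 'a" where
  "ad P z w = \<lbrace>z, w\<rbrace>\<^bsub>P\<^esub>"

definition Ev :: "('k, 'm) ring_scheme \<Rightarrow> ('k, 'a, 'n) poisson_scheme \<Rightarrow> 'a \<Rightarrow> 'k set" where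
  "Ev K P z = {c \<in> carrier K. \<exists>x\<in>carrier P - {\<zero>\<^bsub>P\<^esub>}. ad P z x = c \<odot>\<^bsub>P\<^esub> x}"

definition F_set :: "('k, 'm) ring_scheme \<Rightarrow> ('k, 'a, 'n) poisson_scheme \<Rightarrow> 'a \<Rightarrow> 'a set" where
  "F_set K P z =
     {x \<in> carrier P. fin_dim_subspace K P (module.span K P {(ad P z ^^ n) x | n. True})}"

definition N_set :: "('k, 'a, 'n) poisson_scheme \<Rightarrow> 'a \<Rightarrow> 'a set" where
  "N_set P z = {x \<in> carrier P. \<exists>m. (ad P z ^^ m) x = \<zero>\<^bsub>P\<^esub>}"

definition C_set :: "('k, 'a, 'n) poisson_scheme \<Rightarrow> 'a \<Rightarrow> 'a set" where
  "C_set P z = {x \<in> carrier P. ad P z x = \<zero>\<^bsub>P\<^esub>}"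

text \<open>
  Eigenspaces for distinct eigenvalues are independent, so the internal direct sum of all of
  them is the span of their union.
\<close>

definition D_set :: "('k, 'm) ring_scheme \<Rightarrow> ('k, 'a, 'n) poisson_scheme \<Rightarrow> 'a \<Rightarrow> 'a set" where
  "D_set K P z =
     module.span K P (\<Union>c\<in>Ev K P z. {x \<in> carrier P. ad P z x = c \<odot>\<^bsub>P\<^esub> x})"

definition Omega1 :: "('k, 'm) ring_scheme \<Rightarrow> ('k, 'a, 'n) poisson_scheme \<Rightarrow> 'a set" where
  "Omega1 K P = {z \<in> carrier P. Ev K P z = {\<zero>\<^bsub>K\<^esub>} \<and> C_set P z \<subset> N_set P z \<and> N_set P z = carrier P}"

definition Omega1' :: "('k, 'm) ring_scheme \<Rightarrow> ('k, 'a, 'n) poisson_scheme \<Rightarrow> 'a set" where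
  "Omega1' K P = {z \<in> carrier P. Ev K P z = {\<zero>\<^bsub>K\<^esub>} \<and> C_set P z \<subset> N_set P z \<and> N_set P z \<subset> carrier P}"

definition nilpotent_elements :: "('k, 'm) ring_scheme \<Rightarrow> ('k, 'a, 'n) poisson_scheme \<Rightarrow> 'a set" where
  "nilpotent_elements K P = Omega1 K P \<union> Omega1' K P"

end

theory Submission
  imports Defs
begin

text \<open>
  The adjoint map of \<open>\<Gamma>\<close> is \<open>d = f \<otimes> 1 + 1 \<otimes> g\<close> with \<open>f = ad z1\<close> and \<open>g = ad z2\<close>. For a linear
  functional \<open>\<psi>\<close> on \<open>P1\<close> let \<open>L\<^sub>\<psi> : P1 \<otimes> P2 \<rightarrow> P2\<close> be the contraction \<open>a \<otimes> b \<mapsto> \<psi>(a) b\<close>. Then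
  \<open>g \<circ> L\<^sub>\<psi> = L\<^sub>\<psi> \<circ> d - L\<^sub>\<chi>\<close> with \<open>\<chi> = \<psi> \<circ> f\<close>, so all contractions of a finite-dimensional \<open>d\<close>-stable space
  span a finite-dimensional \<open>g\<close>-stable space. Hence every contraction of an element of \<open>F(\<Gamma>)\<close> lies in
  \<open>F(z2) = N(z2)\<close>, and symmetrically in \<open>F(z1) = N(z1)\<close> on the other side. A tensor all of whose
  contractions lie in \<open>N(z1)\<close> and \<open>N(z2)\<close> belongs to \<open>N(z1) \<otimes> N(z2)\<close>, which is contained in \<open>N(\<Gamma>)\<close>.
\<close>

section \<open>Linear functionals and finite-dimensional subspaces\<close>

text \<open>Contracting by \<psi> and applying \<open>g\<close> brings in \<psi> o f, then \<psi> o
  f^2 and so on, and these functionals need not span a finite-dimensional space. Finiteness must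
  therefore come from the tensors alone: finitely many tensors span the orbit of x under d, only
  finitely many vectors of the second factor occur in them, and the span of these vectors contains
  every contraction of the orbit, for all functionals at once. No basis of a factor is chosen; its
  place is taken by functionals that separate a vector from a subspace. The concrete tensor product
  is a quotient of a free abelian group, so its universal property has to be established before
  contractions exist; the contraction argument itself sees only an abstract space generated by pure
  tensors.\<close>

definition linear_functionals ::
  "('k, 'm) ring_scheme \<Rightarrow> ('k, 'v, 'n) module_scheme \<Rightarrow> ('v \<Rightarrow> 'k) set" where
  "linear_functionals K V = {\<phi> \<in> carrier V \<rightarrow> carrier K.
     (\<forall>x\<in>carrier V. \<forall>y\<in>carrier V. \<phi> (x \<oplus>\<^bsub>V\<^esub> y) = \<phi> x \<oplus>\<^bsub>K\<^esub> \<phi> y) \<and>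
     (\<forall>c\<in>carrier K. \<forall>x\<in>carrier V. \<phi> (c \<odot>\<^bsub>V\<^esub> x) = c \<otimes>\<^bsub>K\<^esub> \<phi> x)}"

lemma linear_functionals_closed:
  "\<lbrakk>\<phi> \<in> linear_functionals K V; x \<in> carrier V\<rbrakk> \<Longrightarrow> \<phi> x \<in> carrier K"
  and linear_functionals_add:
  "\<lbrakk>\<phi> \<in> linear_functionals K V; x \<in> carrier V; y \<in> carrier V\<rbrakk>
    \<Longrightarrow> \<phi> (x \<oplus>\<^bsub>V\<^esub> y) = \<phi> x \<oplus>\<^bsub>K\<^esub> \<phi> y"
  and linear_functionals_smult:
  "\<lbrakk>\<phi> \<in> linear_functionals K V; c \<in> carrier K; x \<in> carrier V\<rbrakk>
    \<Longrightarrow> \<phi> (c \<odot>\<^bsub>V\<^esub> x) = c \<otimes>\<^bsub>K\<^esub> \<phi> x"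
  by (auto simp: linear_functionals_def)

lemma linear_functionals_comp:
  assumes "\<phi> \<in> linear_functionals K W" "f \<in> module_hom K V W"
  shows "(\<lambda>x. \<phi> (f x)) \<in> linear_functionals K V"
  using assms by (auto simp: linear_functionals_def module_hom_def Pi_iff)

lemma (in abelian_group) a_inv_zero: "\<ominus> \<zero> = \<zero>"
  using r_neg[of \<zero>] by simp

lemma submodule_minus_closed:
  assumes "submodule K M V" "x \<in> M" "y \<in> M"
  shows "x \<ominus>\<^bsub>V\<^esub> y \<in> M"
proof -
  interpret submodule K M V by fact
  interpret module K V by (rule module)
  have "\<ominus>\<^bsub>V\<^esub> y = (\<ominus>\<^bsub>K\<^esub> \<one>\<^bsub>K\<^esub>) \<odot>\<^bsub>V\<^esub> y"
    by (rule smult_minus_1[symmetric]) (use subset assms in auto)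
  then have "\<ominus>\<^bsub>V\<^esub> y \<in> M" using assms by simp
  then show ?thesis using assms by (simp add: a_minus_def)
qed

context vectorspace
begin

text \<open>Zorn's lemma applies because the union of a nonempty chain of submodules is a submodule,
  and it avoids \<open>v\<close> when every member does.\<close>

lemma submodule_maximal_avoiding:
  assumes M: "submodule K M V" and v: "v \<notin> M"
  obtains H where "submodule K H V" "M \<subseteq> H" "v \<notin> H"
    "\<And>N. \<lbrakk>submodule K N V; H \<subseteq> N; v \<notin> N\<rbrakk> \<Longrightarrow> N = H"
proof -
  define \<A> where "\<A> = {N. submodule K N V \<and> M \<subseteq> N \<and> v \<notin> N}"
  have "\<Union>C \<in> \<A>" if "C \<noteq> {}" and ch: "subset.chain \<A> C" for C
  proof -
    have C: "C \<subseteq> \<A>" and tot: "\<And>A B. \<lbrakk>A \<in> C; B \<in> C\<rbrakk> \<Longrightarrow> A \<subseteq> B \<or> B \<subseteq> A"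
      using ch by (auto simp: subset_chain_def)
    have "submodule K (\<Union>C) V"
    proof (rule nested_union_vs[where I = C and N = "\<lambda>A. A"])
      show "\<And>A. A \<in> C \<Longrightarrow> submodule K A V" using C by (auto simp: \<A>_def)
      show "\<exists>D. D \<in> C \<and> A \<subseteq> D \<and> B \<subseteq> D" if "A \<in> C" "B \<in> C" for A B
        using tot[OF that] that by blast
    qed (use \<open>C \<noteq> {}\<close> in auto)
    then show ?thesis using C \<open>C \<noteq> {}\<close> by (auto simp: \<A>_def)
  qed
  moreover have "\<A> \<noteq> {}" using M v by (auto simp: \<A>_def)
  ultimately obtain H where "H \<in> \<A>" "\<forall>N\<in>\<A>. H \<subseteq> N \<longrightarrow> N = H"
    using subset_Zorn_nonempty[of \<A>] by blast
  then show thesis by (intro that) (auto simp: \<A>_def)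
qed

text \<open>The enlargement of \<open>H\<close> by one vector is written out explicitly, so that
  membership of \<open>v\<close> in it yields a coefficient of \<open>x\<close> that can be
  inverted.\<close>

lemma submodule_adjoin:
  assumes H: "submodule K H V" and x: "x \<in> carrier V"
  defines "N \<equiv> {h \<oplus>\<^bsub>V\<^esub> c \<odot>\<^bsub>V\<^esub> x | h c. h \<in> H \<and> c \<in> carrier K}"
  shows "submodule K N V" "H \<subseteq> N" "x \<in> N"
proof -
  interpret H: submodule K H V by fact
  have HV: "\<And>h. h \<in> H \<Longrightarrow> h \<in> carrier V" using H.subset by auto
  show "submodule K N V"
  proof
    show "N \<subseteq> carrier V" using x HV by (auto simp: N_def)
    show "\<zero>\<^bsub>V\<^esub> \<in> N"
      unfolding N_def by (rule CollectI, rule exI[of _ "\<zero>\<^bsub>V\<^esub>"], rule exI[of _ "\<zero>\<^bsub>K\<^esub>"]) (use x in simp)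
    fix a b assume "a \<in> N" "b \<in> N"
    then obtain h c g d where *: "a = h \<oplus>\<^bsub>V\<^esub> c \<odot>\<^bsub>V\<^esub> x" "b = g \<oplus>\<^bsub>V\<^esub> d \<odot>\<^bsub>V\<^esub> x"
      "h \<in> H" "g \<in> H" "c \<in> carrier K" "d \<in> carrier K"
      by (auto simp: N_def)
    have "a \<oplus>\<^bsub>V\<^esub> b = (h \<oplus>\<^bsub>V\<^esub> g) \<oplus>\<^bsub>V\<^esub> (c \<oplus>\<^bsub>K\<^esub> d) \<odot>\<^bsub>V\<^esub> x"
      using * x HV by (simp add: smult_l_distr M.a_ac)
    then show "a \<oplus>\<^bsub>V\<^esub> b \<in> N" using * unfolding N_def by blast
  next
    fix e a assume "e \<in> carrier K" "a \<in> N"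
    then obtain h c where *: "a = h \<oplus>\<^bsub>V\<^esub> c \<odot>\<^bsub>V\<^esub> x" "h \<in> H" "c \<in> carrier K"
      by (auto simp: N_def)
    have "e \<odot>\<^bsub>V\<^esub> a = e \<odot>\<^bsub>V\<^esub> h \<oplus>\<^bsub>V\<^esub> (e \<otimes>\<^bsub>K\<^esub> c) \<odot>\<^bsub>V\<^esub> x"
      using * x HV \<open>e \<in> carrier K\<close> by (simp add: smult_r_distr smult_assoc1)
    then show "e \<odot>\<^bsub>V\<^esub> a \<in> N" using * \<open>e \<in> carrier K\<close> unfolding N_def by blast
  qed
  show "H \<subseteq> N"
  proof
    fix h assume "h \<in> H"
    then have "h = h \<oplus>\<^bsub>V\<^esub> \<zero>\<^bsub>K\<^esub> \<odot>\<^bsub>V\<^esub> x" using x HV by simp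
    then show "h \<in> N" unfolding N_def using \<open>h \<in> H\<close> by blast
  qed
  have "x = \<zero>\<^bsub>V\<^esub> \<oplus>\<^bsub>V\<^esub> \<one>\<^bsub>K\<^esub> \<odot>\<^bsub>V\<^esub> x" using x by simp
  then show "x \<in> N" unfolding N_def using H.zero_closed by blast
qed

text \<open>A submodule that is maximal among those avoiding \<open>v\<close> is a complement of the line through
  \<open>v\<close>; the functional is the projection to that line.\<close>

lemma linear_functional_separates:
  assumes M: "submodule K M V" and v: "v \<in> carrier V" "v \<notin> M"
  obtains \<phi> where "\<phi> \<in> linear_functionals K V" "\<phi> v = \<one>\<^bsub>K\<^esub>" "\<And>m. m \<in> M \<Longrightarrow> \<phi> m = \<zero>\<^bsub>K\<^esub>"
proof -
  obtain H where H: "submodule K H V" "M \<subseteq> H" "v \<notin> H"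
    and max: "\<And>N. \<lbrakk>submodule K N V; H \<subseteq> N; v \<notin> N\<rbrakk> \<Longrightarrow> N = H"
    using submodule_maximal_avoiding[OF M v(2)] by blast
  interpret H: submodule K H V by (rule H)
  have HV: "\<And>h. h \<in> H \<Longrightarrow> h \<in> carrier V" using H.subset by auto
  \<comment> \<open>Dividing by a nonzero \<open>c\<close> would put \<open>v\<close> into
    \<open>H\<close>, so the line through \<open>v\<close> meets \<open>H\<close> only in
    zero.\<close>
  have scale: "c = \<zero>\<^bsub>K\<^esub>" if "c \<in> carrier K" "c \<odot>\<^bsub>V\<^esub> v \<in> H" for c
  proof (rule ccontr)
    assume "c \<noteq> \<zero>\<^bsub>K\<^esub>"
    then have "v = inv\<^bsub>K\<^esub> c \<odot>\<^bsub>V\<^esub> (c \<odot>\<^bsub>V\<^esub> v)" using mult_inverse v that by blast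
    moreover have "inv\<^bsub>K\<^esub> c \<in> carrier K" using that \<open>c \<noteq> \<zero>\<^bsub>K\<^esub>\<close> by simp
    ultimately show False using that H(3) H.smult_closed by metis
  qed
  have ex: "\<exists>c\<in>carrier K. x \<ominus>\<^bsub>V\<^esub> c \<odot>\<^bsub>V\<^esub> v \<in> H" if x: "x \<in> carrier V" for x
  proof (cases "x \<in> H")
    case True
    then have "x \<ominus>\<^bsub>V\<^esub> \<zero>\<^bsub>K\<^esub> \<odot>\<^bsub>V\<^esub> v \<in> H" using v x by (simp add: a_minus_def M.a_inv_zero)
    then show ?thesis by blast
  next
    case False
    \<comment> \<open>Adjoining \<open>x\<close> enlarges \<open>H\<close> strictly, so by
      maximality the enlargement can no longer avoid \<open>v\<close>; solving for \<open>x\<close>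
      below gives its component along \<open>v\<close>.\<close>
    have "v \<in> {h \<oplus>\<^bsub>V\<^esub> c \<odot>\<^bsub>V\<^esub> x | h c. h \<in> H \<and> c \<in> carrier K}"
      using max[OF submodule_adjoin(1)[OF H(1) x] submodule_adjoin(2)[OF H(1) x]]
        submodule_adjoin(3)[OF H(1) x] False by blast
    then obtain h c where hc: "v = h \<oplus>\<^bsub>V\<^esub> c \<odot>\<^bsub>V\<^esub> x" "h \<in> H" "c \<in> carrier K" by blast
    have c0: "c \<noteq> \<zero>\<^bsub>K\<^esub>"
    proof
      assume "c = \<zero>\<^bsub>K\<^esub>"
      then have "v = h" using hc(1) x HV[OF hc(2)] by simp
      then show False using H(3) hc(2) by simp
    qed
    define d where "d = inv\<^bsub>K\<^esub> c"
    have d: "d \<in> carrier K" "d \<otimes>\<^bsub>K\<^esub> c = \<one>\<^bsub>K\<^esub>" using hc c0 by (auto simp: d_def field_Units R.Units_l_inv)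
    have "d \<odot>\<^bsub>V\<^esub> v = d \<odot>\<^bsub>V\<^esub> h \<oplus>\<^bsub>V\<^esub> x"
      unfolding hc(1) using hc(2,3) d x HV by (simp add: smult_r_distr smult_assoc1[symmetric])
    then have "x \<ominus>\<^bsub>V\<^esub> d \<odot>\<^bsub>V\<^esub> v = \<ominus>\<^bsub>V\<^esub> (d \<odot>\<^bsub>V\<^esub> h)"
      using x d hc HV v by (simp add: a_minus_def M.minus_add M.a_ac M.r_neg1 M.r_neg2)
    then have "x \<ominus>\<^bsub>V\<^esub> d \<odot>\<^bsub>V\<^esub> v = \<zero>\<^bsub>V\<^esub> \<ominus>\<^bsub>V\<^esub> (d \<odot>\<^bsub>V\<^esub> h)"
      using d hc HV by (simp add: a_minus_def)
    then have "x \<ominus>\<^bsub>V\<^esub> d \<odot>\<^bsub>V\<^esub> v \<in> H"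
      using submodule_minus_closed[OF H(1)] d hc H.smult_closed H.zero_closed by metis
    then show ?thesis using d by blast
  qed
  \<comment> \<open>Two admissible coefficients differ by a scalar whose multiple of
    \<open>v\<close> lies in \<open>H\<close>, so \<open>scale\<close> makes them equal. Linearity
    of \<phi> then only requires exhibiting an admissible coefficient for a sum or a
    multiple.\<close>
  have uniq: "c = d" if "c \<in> carrier K" "d \<in> carrier K" "x \<in> carrier V"
    "x \<ominus>\<^bsub>V\<^esub> c \<odot>\<^bsub>V\<^esub> v \<in> H" "x \<ominus>\<^bsub>V\<^esub> d \<odot>\<^bsub>V\<^esub> v \<in> H" for c d x
  proof -
    have "(x \<ominus>\<^bsub>V\<^esub> d \<odot>\<^bsub>V\<^esub> v) \<ominus>\<^bsub>V\<^esub> (x \<ominus>\<^bsub>V\<^esub> c \<odot>\<^bsub>V\<^esub> v) \<in> H"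
      using submodule_minus_closed[OF H(1)] that by blast
    also have "(x \<ominus>\<^bsub>V\<^esub> d \<odot>\<^bsub>V\<^esub> v) \<ominus>\<^bsub>V\<^esub> (x \<ominus>\<^bsub>V\<^esub> c \<odot>\<^bsub>V\<^esub> v) = c \<odot>\<^bsub>V\<^esub> v \<ominus>\<^bsub>V\<^esub> d \<odot>\<^bsub>V\<^esub> v"
      using that v by (simp add: a_minus_def M.minus_add M.a_ac M.r_neg1 M.r_neg2)
    also have "\<dots> = (c \<ominus>\<^bsub>K\<^esub> d) \<odot>\<^bsub>V\<^esub> v"
      using that v by (simp add: a_minus_def smult_l_distr smult_l_minus)
    finally have "c \<ominus>\<^bsub>K\<^esub> d = \<zero>\<^bsub>K\<^esub>" using scale that by simp
    then show ?thesis using that by simp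
  qed
  define \<phi> where "\<phi> x = (SOME c. c \<in> carrier K \<and> x \<ominus>\<^bsub>V\<^esub> c \<odot>\<^bsub>V\<^esub> v \<in> H)" for x
  have \<phi>: "\<phi> x \<in> carrier K" "x \<ominus>\<^bsub>V\<^esub> \<phi> x \<odot>\<^bsub>V\<^esub> v \<in> H" if "x \<in> carrier V" for x
    using someI_ex[of "\<lambda>c. c \<in> carrier K \<and> x \<ominus>\<^bsub>V\<^esub> c \<odot>\<^bsub>V\<^esub> v \<in> H"] ex[OF that]
    by (auto simp: \<phi>_def)
  have \<phi>_eq: "\<phi> x = c" if "x \<in> carrier V" "c \<in> carrier K" "x \<ominus>\<^bsub>V\<^esub> c \<odot>\<^bsub>V\<^esub> v \<in> H" for x c
    using uniq[OF \<phi>(1) _ _ \<phi>(2)] that by blast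
  show thesis
  proof
    have "\<phi> (x \<oplus>\<^bsub>V\<^esub> y) = \<phi> x \<oplus>\<^bsub>K\<^esub> \<phi> y" if "x \<in> carrier V" "y \<in> carrier V" for x y
    proof (rule \<phi>_eq)
      have "(x \<ominus>\<^bsub>V\<^esub> \<phi> x \<odot>\<^bsub>V\<^esub> v) \<oplus>\<^bsub>V\<^esub> (y \<ominus>\<^bsub>V\<^esub> \<phi> y \<odot>\<^bsub>V\<^esub> v) \<in> H" using \<phi> that by simp
      also have "(x \<ominus>\<^bsub>V\<^esub> \<phi> x \<odot>\<^bsub>V\<^esub> v) \<oplus>\<^bsub>V\<^esub> (y \<ominus>\<^bsub>V\<^esub> \<phi> y \<odot>\<^bsub>V\<^esub> v)
          = (x \<oplus>\<^bsub>V\<^esub> y) \<ominus>\<^bsub>V\<^esub> (\<phi> x \<oplus>\<^bsub>K\<^esub> \<phi> y) \<odot>\<^bsub>V\<^esub> v"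
        using \<phi>(1) that v by (simp add: a_minus_def smult_l_distr M.minus_add M.a_ac)
      finally show "(x \<oplus>\<^bsub>V\<^esub> y) \<ominus>\<^bsub>V\<^esub> (\<phi> x \<oplus>\<^bsub>K\<^esub> \<phi> y) \<odot>\<^bsub>V\<^esub> v \<in> H" .
    qed (use \<phi>(1) that in auto)
    moreover have "\<phi> (c \<odot>\<^bsub>V\<^esub> x) = c \<otimes>\<^bsub>K\<^esub> \<phi> x" if "c \<in> carrier K" "x \<in> carrier V" for c x
    proof (rule \<phi>_eq)
      have "c \<odot>\<^bsub>V\<^esub> (x \<ominus>\<^bsub>V\<^esub> \<phi> x \<odot>\<^bsub>V\<^esub> v) \<in> H" using \<phi> that by simp
      also have "c \<odot>\<^bsub>V\<^esub> (x \<ominus>\<^bsub>V\<^esub> \<phi> x \<odot>\<^bsub>V\<^esub> v) = c \<odot>\<^bsub>V\<^esub> x \<ominus>\<^bsub>V\<^esub> (c \<otimes>\<^bsub>K\<^esub> \<phi> x) \<odot>\<^bsub>V\<^esub> v"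
        using \<phi>(1) that v by (simp add: a_minus_def smult_r_distr smult_r_minus smult_assoc1)
      finally show "c \<odot>\<^bsub>V\<^esub> x \<ominus>\<^bsub>V\<^esub> (c \<otimes>\<^bsub>K\<^esub> \<phi> x) \<odot>\<^bsub>V\<^esub> v \<in> H" .
    qed (use \<phi>(1) that in auto)
    ultimately show "\<phi> \<in> linear_functionals K V" using \<phi>(1) by (auto simp: linear_functionals_def)
    show "\<phi> v = \<one>\<^bsub>K\<^esub>" using v by (intro \<phi>_eq) (auto simp: a_minus_def M.r_neg)
    show "\<phi> m = \<zero>\<^bsub>K\<^esub>" if "m \<in> M" for m
      using that H(2) HV v by (intro \<phi>_eq) (auto simp: a_minus_def M.a_inv_zero)
  qed
qed

text \<open>A subset independent in \<open>U\<close> is independent in the span of \<open>Y\<close>,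
  so it has at most \<open>card Y\<close> elements; one of greatest size is then a basis of
  \<open>U\<close>.\<close>

lemma fin_dim_submodule:
  assumes U: "submodule K U V" and Y: "finite Y" "Y \<subseteq> carrier V" "U \<subseteq> span Y"
  shows "vectorspace.fin_dim K (vs U)"
proof -
  have vsp: "vectorspace K V" ..
  have sY: "submodule K (span Y) V" using Y by (intro span_is_submodule)
  interpret Y: vectorspace K "vs (span Y)"
    by (intro subspace_is_vs) (simp add: subspace_def sY vsp)
  interpret U: vectorspace K "vs U"
    by (intro subspace_is_vs) (simp add: subspace_def U vsp)
  have YY: "Y \<subseteq> span Y" by (rule in_own_span[OF Y(2)])
  have genY: "Y.gen_set Y" using span_li_not_depend(1)[OF YY sY] by simp
  have fdY: "Y.fin_dim" unfolding Y.fin_dim_def using Y(1) YY genY by auto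
  have bound: "finite A \<and> card A \<le> card Y" if "A \<subseteq> U" "U.lin_indpt A" for A
  proof -
    have AY: "A \<subseteq> span Y" using that Y by auto
    have "lin_indpt A" using span_li_not_depend(2)[OF that(1) U] that by simp
    then have li: "Y.lin_indpt A" using span_li_not_depend(2)[OF AY sY] by simp
    then have "finite A" using Y.fin_dim_li_fin fdY AY by simp
    then show ?thesis using Y.li_smaller_than_gen[of A Y] li AY Y(1) YY genY by simp
  qed
  have "U.lin_indpt {}" by (simp add: U.lin_dep_def)
  then obtain A where A: "A \<subseteq> U" "U.lin_indpt A"
    and max: "\<And>B. \<lbrakk>B \<subseteq> U; U.lin_indpt B\<rbrakk> \<Longrightarrow> card B \<le> card A"
    using ex_has_greatest_nat[of "\<lambda>A. A \<subseteq> U \<and> U.lin_indpt A" "{}" card "Suc (card Y)"] bound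
    by (auto simp: less_Suc_eq_le)
  \<comment> \<open>Greatest cardinality implies maximality for inclusion, as the competing sets are
    finite.\<close>
  have "maximal A (\<lambda>S. S \<subseteq> carrier (vs U) \<and> U.lin_indpt S)"
    unfolding maximal_def
  proof (intro conjI allI impI, goal_cases)
    case (3 B)
    then show ?case using card_seteq[of B A] max[of B] bound[of B] by auto
  qed (use A in auto)
  then have "U.basis A" using U.max_li_is_basis bound[OF A] by blast
  then show ?thesis unfolding U.fin_dim_def U.basis_def using bound[OF A] by blast
qed

end

lemma module_hom_zero:
  assumes "module K V" "module K W" "f \<in> module_hom K V W"
  shows "f \<zero>\<^bsub>V\<^esub> = \<zero>\<^bsub>W\<^esub>"
proof -
  interpret mod_hom K V W f using assms by (simp add: mod_hom_def mod_hom_axioms_def)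
  show ?thesis by simp
qed

lemma module_hom_minus:
  assumes "module K V" "module K W" "f \<in> module_hom K V W" "x \<in> carrier V" "y \<in> carrier V"
  shows "f (x \<ominus>\<^bsub>V\<^esub> y) = f x \<ominus>\<^bsub>W\<^esub> f y"
proof -
  interpret mod_hom K V W f using assms by (simp add: mod_hom_def mod_hom_axioms_def)
  have "f (\<ominus>\<^bsub>V\<^esub> y) = \<ominus>\<^bsub>W\<^esub> f y"
    using assms f_smult[of "\<ominus>\<^bsub>K\<^esub> \<one>\<^bsub>K\<^esub>" y]
    by (simp add: M.smult_l_minus N.smult_l_minus)
  then show ?thesis using assms by (simp add: a_minus_def)
qed

lemma module_hom_funpow:
  assumes "f \<in> module_hom K V V"
  shows "f ^^ n \<in> module_hom K V V"
  by (induction n) (use assms in \<open>auto simp: module_hom_def Pi_iff\<close>)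

section \<open>Nilpotent and locally finite parts of an endomorphism\<close>

text \<open>With \<open>f\<close> an adjoint map this is \<open>N_set\<close>, and
  \<open>locally_finite_part\<close> below is \<open>F_set\<close>. Both are stated for any map so
  that one argument serves the two factors and the tensor product.\<close>

definition nil_part :: "('k, 'v, 'n) module_scheme \<Rightarrow> ('v \<Rightarrow> 'v) \<Rightarrow> 'v set" where
  "nil_part V f = {x \<in> carrier V. \<exists>m. (f ^^ m) x = \<zero>\<^bsub>V\<^esub>}"

definition locally_finite_part ::
  "('k, 'm) ring_scheme \<Rightarrow> ('k, 'v, 'n) module_scheme \<Rightarrow> ('v \<Rightarrow> 'v) \<Rightarrow> 'v set" where
  "locally_finite_part K V f = {x \<in> carrier V.
     vectorspace.fin_dim K (V\<lparr>carrier := module.span K V {(f ^^ n) x | n. True}\<rparr>)}"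

context vectorspace
begin

lemma funpow_closed:
  assumes "f \<in> module_hom K V V" "x \<in> carrier V"
  shows "(f ^^ n) x \<in> carrier V"
  using module_hom_closed[OF module_hom_funpow[OF assms(1)]] assms(2) by blast

lemma funpow_zero:
  assumes f: "f \<in> module_hom K V V" and "(f ^^ m) x = \<zero>\<^bsub>V\<^esub>" "m \<le> n"
  shows "(f ^^ n) x = \<zero>\<^bsub>V\<^esub>"
proof -
  have "(f ^^ n) x = (f ^^ (n - m)) ((f ^^ m) x)"
    using assms(3) by (simp flip: funpow_add comp_apply[of "f ^^ (n - m)"])
  then show ?thesis
    using assms(2) module_hom_zero[OF _ _ module_hom_funpow[OF f]] module_axioms by simp
qed

lemma submodule_nil_part:
  assumes f: "f \<in> module_hom K V V"
  shows "submodule K (nil_part V f) V"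
proof
  note fn = module_hom_funpow[OF f]
  show "\<zero>\<^bsub>V\<^esub> \<in> nil_part V f" by (auto simp: nil_part_def intro: exI[of _ 0])
  fix x y assume xy: "x \<in> nil_part V f" "y \<in> nil_part V f"
  then obtain m n where mn: "(f ^^ m) x = \<zero>\<^bsub>V\<^esub>" "(f ^^ n) y = \<zero>\<^bsub>V\<^esub>" by (auto simp: nil_part_def)
  have "(f ^^ max m n) (x \<oplus>\<^bsub>V\<^esub> y) = \<zero>\<^bsub>V\<^esub>"
    using xy funpow_zero[OF f mn(1), of "max m n"] funpow_zero[OF f mn(2), of "max m n"]
    by (simp add: module_hom_add[OF fn] nil_part_def)
  then show "x \<oplus>\<^bsub>V\<^esub> y \<in> nil_part V f" using xy by (auto simp: nil_part_def)
next
  fix c x assume "c \<in> carrier K" "x \<in> nil_part V f"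
  moreover from this obtain m where "(f ^^ m) x = \<zero>\<^bsub>V\<^esub>" by (auto simp: nil_part_def)
  ultimately have "(f ^^ m) (c \<odot>\<^bsub>V\<^esub> x) = \<zero>\<^bsub>V\<^esub>"
    by (simp add: module_hom_smult[OF module_hom_funpow[OF f]] nil_part_def)
  then show "c \<odot>\<^bsub>V\<^esub> x \<in> nil_part V f"
    using \<open>c \<in> carrier K\<close> \<open>x \<in> nil_part V f\<close> by (auto simp: nil_part_def)
qed (auto simp: nil_part_def)

text \<open>The finite set may span more than the orbit does: a subspace of a finitely spanned space
  is again finite-dimensional.\<close>

lemma locally_finite_partI:
  assumes f: "f \<in> module_hom K V V" and x: "x \<in> carrier V"
    and Y: "finite Y" "Y \<subseteq> carrier V" "\<And>n. (f ^^ n) x \<in> span Y"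
  shows "x \<in> locally_finite_part K V f"
proof -
  have c: "{(f ^^ n) x | n. True} \<subseteq> carrier V" using funpow_closed[OF f x] by auto
  have "span {(f ^^ n) x | n. True} \<subseteq> span Y"
    using Y by (intro span_is_subset span_is_submodule) auto
  then have "vectorspace.fin_dim K (vs (span {(f ^^ n) x | n. True}))"
    using fin_dim_submodule[OF span_is_submodule[OF c] Y(1,2)] by simp
  then show ?thesis using x by (simp add: locally_finite_part_def)
qed

lemma nil_part_subset_locally_finite_part:
  assumes f: "f \<in> module_hom K V V"
  shows "nil_part V f \<subseteq> locally_finite_part K V f"
proof
  fix x assume "x \<in> nil_part V f"
  then obtain m where x: "x \<in> carrier V" and m: "(f ^^ m) x = \<zero>\<^bsub>V\<^esub>" by (auto simp: nil_part_def)
  \<comment> \<open>The index \<open>m\<close> is included so that the zero vector is in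
    \<open>?Y\<close> and accounts for all later iterates.\<close>
  let ?Y = "(\<lambda>n. (f ^^ n) x) ` {..m}"
  have Y: "?Y \<subseteq> carrier V" using funpow_closed[OF f x] by auto
  have "(f ^^ n) x \<in> ?Y" for n
  proof (cases "n \<le> m")
    case False
    then have "(f ^^ n) x = (f ^^ m) x" using funpow_zero[OF f m, of n] m by simp
    then show ?thesis by blast
  qed blast
  then show "x \<in> locally_finite_part K V f"
    using locally_finite_partI[OF f x _ Y] in_own_span[OF Y] by blast
qed

text \<open>The definition provides generators inside the span of the orbit; since spans do not
  depend on the ambient space, they may be used in \<open>V\<close>.\<close>

lemma locally_finite_part_span:
  assumes f: "f \<in> module_hom K V V" and x: "x \<in> locally_finite_part K V f"
  obtains A where "finite A" "A \<subseteq> carrier V" "\<And>n. (f ^^ n) x \<in> span A"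
proof -
  let ?S = "{(f ^^ n) x | n. True}"
  have xV: "x \<in> carrier V" using x by (simp add: locally_finite_part_def)
  have S: "?S \<subseteq> carrier V" using funpow_closed[OF f xV] by auto
  note sub = span_is_submodule[OF S]
  interpret U: vectorspace K "vs (span ?S)"
    using subspace_is_vs[OF span_is_subspace[OF S]] .
  have "U.fin_dim" using x by (simp add: locally_finite_part_def)
  then obtain A where A: "finite A" "A \<subseteq> span ?S" "U.span A = span ?S"
    unfolding U.fin_dim_def carrier_vs_is_self by blast
  then have "span A = span ?S" using span_li_not_depend(1)[OF A(2) sub] by simp
  moreover have "A \<subseteq> carrier V" using A(2) sub by (auto simp: submodule_def)
  moreover have "(f ^^ n) x \<in> span ?S" for n using in_own_span[OF S] by blast
  ultimately show thesis using that A(1) by metis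
qed

end

text \<open>Iterating \<open>f\<close> on \<open>x\<close> multiplies by powers of \<open>c\<close>,
  and a nonzero scalar of a field never turns a nonzero vector into zero.\<close>

lemma (in vectorspace) eigenvalue_nilpotent:
  assumes f: "f \<in> module_hom K V V" and c: "c \<in> carrier K" and x: "x \<in> nil_part V f" "x \<noteq> \<zero>\<^bsub>V\<^esub>"
    and fx: "f x = c \<odot>\<^bsub>V\<^esub> x"
  shows "c = \<zero>\<^bsub>K\<^esub>"
proof (rule ccontr)
  assume nz: "c \<noteq> \<zero>\<^bsub>K\<^esub>"
  have xV: "x \<in> carrier V" using x by (simp add: nil_part_def)
  have scale: "c \<odot>\<^bsub>V\<^esub> y \<noteq> \<zero>\<^bsub>V\<^esub>" if "y \<in> carrier V" "y \<noteq> \<zero>\<^bsub>V\<^esub>" for y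
  proof
    assume "c \<odot>\<^bsub>V\<^esub> y = \<zero>\<^bsub>V\<^esub>"
    then have "y = inv\<^bsub>K\<^esub> c \<odot>\<^bsub>V\<^esub> \<zero>\<^bsub>V\<^esub>" using mult_inverse[OF c that(1) _ nz] by simp
    then show False using that c nz by simp
  qed
  have "(f ^^ m) x \<noteq> \<zero>\<^bsub>V\<^esub>" for m
  proof (induction m)
    case (Suc m)
    have "(f ^^ Suc m) x = (f ^^ m) (c \<odot>\<^bsub>V\<^esub> x)" by (simp only: funpow_Suc_right o_apply fx)
    also have "\<dots> = c \<odot>\<^bsub>V\<^esub> (f ^^ m) x" by (rule module_hom_smult[OF module_hom_funpow[OF f] c xV])
    finally show ?case using scale Suc funpow_closed[OF f xV] by simp
  qed (use x in simp)
  then show False using x by (auto simp: nil_part_def)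
qed

section \<open>Contractions of tensors\<close>

text \<open>All that is used of a tensor product: it is generated by the pure tensors \<open>t v w\<close>, and
  linear functionals on a factor can be contracted against it.\<close>

locale tensor_pairing = V: vectorspace K V + W: vectorspace K W + T: vectorspace K T
  for K :: "('k, 'm) ring_scheme" and V :: "('k, 'v, 'n1) module_scheme"
    and W :: "('k, 'w, 'n2) module_scheme" and T :: "('k, 't, 'n3) module_scheme" +
  fixes t :: "'v \<Rightarrow> 'w \<Rightarrow> 't"
  assumes t_closed: "\<lbrakk>v \<in> carrier V; w \<in> carrier W\<rbrakk> \<Longrightarrow> t v w \<in> carrier T"
    and t_add_left: "\<lbrakk>v \<in> carrier V; v' \<in> carrier V; w \<in> carrier W\<rbrakk>
      \<Longrightarrow> t (v \<oplus>\<^bsub>V\<^esub> v') w = t v w \<oplus>\<^bsub>T\<^esub> t v' w"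
    and t_add_right: "\<lbrakk>v \<in> carrier V; w \<in> carrier W; w' \<in> carrier W\<rbrakk>
      \<Longrightarrow> t v (w \<oplus>\<^bsub>W\<^esub> w') = t v w \<oplus>\<^bsub>T\<^esub> t v w'"
    and t_smult_left: "\<lbrakk>c \<in> carrier K; v \<in> carrier V; w \<in> carrier W\<rbrakk>
      \<Longrightarrow> t (c \<odot>\<^bsub>V\<^esub> v) w = c \<odot>\<^bsub>T\<^esub> t v w"
    and t_smult_right: "\<lbrakk>c \<in> carrier K; v \<in> carrier V; w \<in> carrier W\<rbrakk>
      \<Longrightarrow> t v (c \<odot>\<^bsub>W\<^esub> w) = c \<odot>\<^bsub>T\<^esub> t v w"
    and t_induct: "\<And>Q x. \<lbrakk>x \<in> carrier T; Q \<zero>\<^bsub>T\<^esub>;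
      \<And>v w. \<lbrakk>v \<in> carrier V; w \<in> carrier W\<rbrakk> \<Longrightarrow> Q (t v w);
      \<And>x y. \<lbrakk>x \<in> carrier T; y \<in> carrier T; Q x; Q y\<rbrakk> \<Longrightarrow> Q (x \<oplus>\<^bsub>T\<^esub> y)\<rbrakk> \<Longrightarrow> Q x"
    and ex_contract_left: "\<psi> \<in> linear_functionals K V \<Longrightarrow>
      \<exists>L\<in>module_hom K T W. \<forall>v\<in>carrier V. \<forall>w\<in>carrier W. L (t v w) = \<psi> v \<odot>\<^bsub>W\<^esub> w"
    and ex_contract_right: "\<phi> \<in> linear_functionals K W \<Longrightarrow>
      \<exists>L\<in>module_hom K T V. \<forall>v\<in>carrier V. \<forall>w\<in>carrier W. L (t v w) = \<phi> w \<odot>\<^bsub>V\<^esub> v"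

context tensor_pairing
begin

text \<open>Exchanging the factors turns every result about left contractions into one about right
  contractions, so each is proved on one side only.\<close>

lemma swapped: "tensor_pairing K W V T (\<lambda>w v. t v w)"
proof (unfold_locales, goal_cases)
  case (6 Q x)
  then show ?case using t_induct[of x Q] by blast
next
  case (7 \<psi>)
  then show ?case using ex_contract_right[of \<psi>] by blast
next
  case (8 \<phi>)
  then show ?case using ex_contract_left[of \<phi>] by blast
qed (simp_all add: t_closed t_add_left t_add_right t_smult_left t_smult_right)

text \<open>This is \<psi> \<otimes> id. The pure tensors generate \<open>T\<close>, so a linear map
  with these values is determined on the carrier and the choice is immaterial.\<close>

definition contract_left :: "('v \<Rightarrow> 'k) \<Rightarrow> 't \<Rightarrow> 'w" where
  "contract_left \<psi> = (SOME L. L \<in> module_hom K T W \<and>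
     (\<forall>v\<in>carrier V. \<forall>w\<in>carrier W. L (t v w) = \<psi> v \<odot>\<^bsub>W\<^esub> w))"

lemma contract_left:
  assumes "\<psi> \<in> linear_functionals K V"
  shows contract_left_hom: "contract_left \<psi> \<in> module_hom K T W"
    and contract_left_pure: "\<And>v w. \<lbrakk>v \<in> carrier V; w \<in> carrier W\<rbrakk>
      \<Longrightarrow> contract_left \<psi> (t v w) = \<psi> v \<odot>\<^bsub>W\<^esub> w"
  using someI_ex[of "\<lambda>L. L \<in> module_hom K T W \<and>
     (\<forall>v\<in>carrier V. \<forall>w\<in>carrier W. L (t v w) = \<psi> v \<odot>\<^bsub>W\<^esub> w)"] ex_contract_left[OF assms]
  by (auto simp: contract_left_def)

lemmas contract_left_add = module_hom_add[OF contract_left_hom]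

text \<open>Sums of pure tensors with factors from arbitrary sets. Scalars are absent, since a
  submodule on either side absorbs them; allowing a mere set on the other side makes it possible to
  work with finitely many vectors there.\<close>

inductive_set psums :: "'v set \<Rightarrow> 'w set \<Rightarrow> 't set" for A B where
  psums_zero: "\<zero>\<^bsub>T\<^esub> \<in> psums A B"
| psums_step: "\<lbrakk>v \<in> A; w \<in> B; u \<in> psums A B\<rbrakk> \<Longrightarrow> t v w \<oplus>\<^bsub>T\<^esub> u \<in> psums A B"

lemma psums_closed:
  assumes "A \<subseteq> carrier V" "B \<subseteq> carrier W" "u \<in> psums A B"
  shows "u \<in> carrier T"
  using assms(3) by induction (use assms(1,2) in \<open>auto intro!: T.M.a_closed t_closed\<close>)

lemma psums_mono:
  assumes "u \<in> psums A B" "A \<subseteq> A'" "B \<subseteq> B'"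
  shows "u \<in> psums A' B'"
  using assms by induction (auto intro: psums.intros)

lemma psums_pure:
  assumes "v \<in> A" "w \<in> B" "A \<subseteq> carrier V" "B \<subseteq> carrier W"
  shows "t v w \<in> psums A B"
  using psums_step[OF assms(1,2) psums_zero] assms t_closed[of v w] by (auto simp: subset_iff)

lemma psums_add:
  assumes "u \<in> psums A B" "u' \<in> psums A B" "A \<subseteq> carrier V" "B \<subseteq> carrier W"
  shows "u \<oplus>\<^bsub>T\<^esub> u' \<in> psums A B"
  using assms
proof induction
  case psums_zero
  then show ?case using psums_closed by simp
next
  case (psums_step v w u)
  have "t v w \<oplus>\<^bsub>T\<^esub> u \<oplus>\<^bsub>T\<^esub> u' = t v w \<oplus>\<^bsub>T\<^esub> (u \<oplus>\<^bsub>T\<^esub> u')"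
    using psums_step psums_closed[of A B] t_closed[of v w] by (intro T.M.a_assoc) auto
  then show ?case using psums_step by (auto intro: psums.psums_step)
qed

lemma psums_eq_swapped: "psums A B = tensor_pairing.psums T (\<lambda>w v. t v w) B A"
proof -
  interpret S: tensor_pairing K W V T "\<lambda>w v. t v w" by (rule swapped)
  show ?thesis
  proof (intro equalityI subsetI)
    show "u \<in> S.psums B A" if "u \<in> psums A B" for u
      using that by induction (auto intro: S.psums.intros)
    show "u \<in> psums A B" if "u \<in> S.psums B A" for u
      using that by induction (auto intro: psums.intros)
  qed
qed

text \<open>A scalar moves into the second factor of each summand, which is why only
  \<open>B\<close> has to be a submodule.\<close>

lemma submodule_psums:
  assumes A: "A \<subseteq> carrier V" and B: "submodule K B W"
  shows "submodule K (psums A B) T"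
proof -
  interpret B: submodule K B W by fact
  have "c \<odot>\<^bsub>T\<^esub> u \<in> psums A B" if "c \<in> carrier K" "u \<in> psums A B" for c u
    using that(2)
  proof induction
    case psums_zero
    then show ?case using that psums.psums_zero by simp
  next
    case (psums_step v w u)
    then have vw: "v \<in> carrier V" "w \<in> carrier W" using A B.subset by auto
    have "c \<odot>\<^bsub>T\<^esub> (t v w \<oplus>\<^bsub>T\<^esub> u) = t v (c \<odot>\<^bsub>W\<^esub> w) \<oplus>\<^bsub>T\<^esub> c \<odot>\<^bsub>T\<^esub> u"
      using vw that(1) psums_closed[OF A B.subset psums_step(3)]
      by (simp add: T.smult_r_distr t_smult_right t_closed)
    then show ?case using psums_step that by (auto intro: psums.psums_step)
  qed
  then show ?thesis
    using psums_closed[OF A B.subset] psums_add[OF _ _ A B.subset] psums_zero T.module_axioms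
    by (intro submodule.intro) auto
qed

lemma submodule_psums':
  assumes "submodule K A V" "B \<subseteq> carrier W"
  shows "submodule K (psums A B) T"
  using tensor_pairing.submodule_psums[OF swapped assms(2,1)] by (simp add: psums_eq_swapped)

lemma carrier_psums: "u \<in> carrier T \<Longrightarrow> u \<in> psums (carrier V) (carrier W)"
  by (erule t_induct) (auto intro: psums_zero psums_pure psums_add)

text \<open>A sum has finitely many terms, so the first factors can be restricted to a finite set
  while \<open>B\<close> stays as it is.\<close>

lemma psums_finite:
  assumes "u \<in> psums A B"
  obtains F where "finite F" "F \<subseteq> A" "u \<in> psums F B"
proof -
  have "\<exists>F. finite F \<and> F \<subseteq> A \<and> u \<in> psums F B"
    using assms
  proof induction
    case psums_zero
    then show ?case by (auto intro: psums.psums_zero)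
  next
    case (psums_step v w u)
    then obtain F where F: "finite F" "F \<subseteq> A" "u \<in> psums F B" by blast
    then have "t v w \<oplus>\<^bsub>T\<^esub> u \<in> psums (insert v F) B"
      using psums_step(2) psums_mono[OF F(3) subset_insertI subset_refl] by (intro psums.psums_step) auto
    then show ?case using F psums_step by (intro exI[of _ "insert v F"]) auto
  qed
  then show thesis using that by blast
qed

text \<open>The vectors whose pure tensors with all of \<open>W\<close> are of this form make up a
  submodule containing \<open>A\<close>, hence containing its span.\<close>

lemma psums_span:
  assumes A: "A \<subseteq> carrier V" and v: "v \<in> V.span A" and w: "w \<in> carrier W"
  shows "t v w \<in> psums A (carrier W)"
proof -
  let ?N = "{v \<in> carrier V. \<forall>w\<in>carrier W. t v w \<in> psums A (carrier W)}"
  have sub: "submodule K (psums A (carrier W)) T"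
    using A by (intro submodule_psums) (auto simp: submodule_def W.module_axioms)
  interpret S: submodule K "psums A (carrier W)" T by (rule sub)
  have z: "t \<zero>\<^bsub>V\<^esub> w = \<zero>\<^bsub>T\<^esub>" if "w \<in> carrier W" for w
    using t_smult_left[of "\<zero>\<^bsub>K\<^esub>" "\<zero>\<^bsub>V\<^esub>" w] that t_closed[of "\<zero>\<^bsub>V\<^esub>" w] by simp
  have "submodule K ?N V"
    by (intro submodule.intro V.module_axioms) (auto simp: z t_add_left t_smult_left)
  moreover have "A \<subseteq> ?N" using A psums_pure[of _ A _ "carrier W"] by auto
  ultimately show ?thesis using V.span_is_subset v w by blast
qed

text \<open>All terms with first factor \<open>v\<close> are merged into one by additivity in the
  second factor, so that \<open>v\<close> has a single coefficient \<open>w\<close>.\<close>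

lemma psums_insert:
  assumes u: "u \<in> psums (insert v A) (carrier W)" and v: "v \<in> carrier V" "A \<subseteq> carrier V"
  obtains w u' where "w \<in> carrier W" "u' \<in> psums A (carrier W)" "u = t v w \<oplus>\<^bsub>T\<^esub> u'"
proof -
  have "\<exists>w\<in>carrier W. \<exists>u'\<in>psums A (carrier W). u = t v w \<oplus>\<^bsub>T\<^esub> u'"
    using u
  proof induction
    case psums_zero
    have "\<zero>\<^bsub>T\<^esub> = t v \<zero>\<^bsub>W\<^esub> \<oplus>\<^bsub>T\<^esub> \<zero>\<^bsub>T\<^esub>"
      using t_smult_right[of "\<zero>\<^bsub>K\<^esub>" v "\<zero>\<^bsub>W\<^esub>"] v t_closed[of v "\<zero>\<^bsub>W\<^esub>"] by simp
    then show ?case using psums.psums_zero W.M.zero_closed by blast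
  next
    case (psums_step x y u)
    then obtain w u' where *: "w \<in> carrier W" "u' \<in> psums A (carrier W)" "u = t v w \<oplus>\<^bsub>T\<^esub> u'" by blast
    have u': "u' \<in> carrier T" using psums_closed * v by blast
    show ?case
    proof (cases "x = v")
      case True
      then have "t x y \<oplus>\<^bsub>T\<^esub> u = t v (y \<oplus>\<^bsub>W\<^esub> w) \<oplus>\<^bsub>T\<^esub> u'"
        using * psums_step v u' by (simp add: t_add_right t_closed T.M.a_assoc)
      then show ?thesis using * psums_step by (meson W.M.a_closed)
    next
      case False
      then have "x \<in> A" using psums_step by simp
      then have "t x y \<oplus>\<^bsub>T\<^esub> u = t v w \<oplus>\<^bsub>T\<^esub> (t x y \<oplus>\<^bsub>T\<^esub> u')"
        using * psums_step v u' by (auto simp: t_closed T.M.a_lcomm subset_iff)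
      then show ?thesis using * psums_step \<open>x \<in> A\<close> by (meson psums.psums_step)
    qed
  qed
  then show thesis using that by blast
qed

text \<open>If \<open>v\<close> is not in the span of \<open>F\<close>, contracting with a functional that separates \<open>v\<close> from
  \<open>F\<close> isolates the coefficient of \<open>v\<close>.\<close>

lemma psums_of_contractions:
  assumes "finite F" "F \<subseteq> carrier V" and M: "submodule K M W"
    and "u \<in> psums F (carrier W)"
    and "\<And>\<psi>. \<psi> \<in> linear_functionals K V \<Longrightarrow> contract_left \<psi> u \<in> M"
  shows "u \<in> psums F M"
  using assms(1,2,4,5)
proof (induction arbitrary: u)
  case empty
  from empty(2) show ?case by cases (auto intro: psums_zero)
next
  case (insert v F)
  interpret M: submodule K M W by (rule M)
  have v: "v \<in> carrier V" and F: "F \<subseteq> carrier V" using insert by auto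
  show ?case
  proof (cases "v \<in> V.span F")
    \<comment> \<open>When \<open>v\<close> depends on \<open>F\<close>, its terms are redistributed
      over \<open>F\<close> and the induction hypothesis applies to \<open>u\<close>
      unchanged.\<close>
    case True
    have "x \<in> psums F (carrier W)" if "x \<in> psums (insert v F) (carrier W)" for x
      using that
    proof induction
      case (psums_step x y u)
      then have "t x y \<in> psums F (carrier W)"
        using psums_span[OF F True] psums_pure[of x F y "carrier W"] F by auto
      then show ?case using psums_step psums_add[OF _ _ F] by blast
    qed (rule psums_zero)
    then have "u \<in> psums F M" using insert F by blast
    then show ?thesis by (rule psums_mono) auto
  next
    case False
    obtain \<psi> where \<psi>: "\<psi> \<in> linear_functionals K V" "\<psi> v = \<one>\<^bsub>K\<^esub>"
      "\<And>m. m \<in> V.span F \<Longrightarrow> \<psi> m = \<zero>\<^bsub>K\<^esub>"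
      using V.linear_functional_separates[OF V.span_is_submodule[OF F] v False] by blast
    obtain w u' where u: "w \<in> carrier W" "u' \<in> psums F (carrier W)" "u = t v w \<oplus>\<^bsub>T\<^esub> u'"
      using psums_insert[OF insert.prems(2) v F] by blast
    have u'T: "u' \<in> carrier T" using psums_closed F u by blast
    \<comment> \<open>\<psi> vanishes on all first factors of \<open>u'\<close>, so contracting
      \<open>u\<close> leaves exactly the coefficient \<open>w\<close>, which is thereby in
      \<open>M\<close>.\<close>
    have "contract_left \<psi> u' = \<zero>\<^bsub>W\<^esub>"
      using u(2)
    proof induction
      case psums_zero
      show ?case using module_hom_zero[OF T.module_axioms W.module_axioms contract_left_hom[OF \<psi>(1)]] .
    next
      case (psums_step x y u)
      have "\<psi> x = \<zero>\<^bsub>K\<^esub>" using \<psi>(3) V.in_own_span[OF F] psums_step by blast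
      moreover have "x \<in> carrier V" "u \<in> carrier T" using psums_step F psums_closed by blast+
      ultimately show ?case
        using psums_step by (simp add: contract_left_add[OF \<psi>(1)] contract_left_pure[OF \<psi>(1)] t_closed)
    qed
    then have "contract_left \<psi> u = w"
      using u v u'T \<psi> by (simp add: contract_left_add[OF \<psi>(1)] contract_left_pure[OF \<psi>(1)] t_closed)
    then have wM: "w \<in> M" using insert.prems(3)[OF \<psi>(1)] by simp
    \<comment> \<open>The hypothesis on \<open>u\<close> passes to \<open>u'\<close>, because the
      contraction of the removed term is a multiple of \<open>w\<close> and \<open>w\<close> is
      already in \<open>M\<close>.\<close>
    have "contract_left \<chi> u' \<in> M" if \<chi>: "\<chi> \<in> linear_functionals K V" for \<chi>
    proof -
      have c: "contract_left \<chi> u' \<in> carrier W" using module_hom_closed[OF contract_left_hom[OF \<chi>]] u'T by blast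
      have "\<chi> v \<odot>\<^bsub>W\<^esub> w \<in> M" using wM linear_functionals_closed[OF \<chi> v] by simp
      moreover have "contract_left \<chi> u = \<chi> v \<odot>\<^bsub>W\<^esub> w \<oplus>\<^bsub>W\<^esub> contract_left \<chi> u'"
        using u v u'T by (simp add: contract_left_add[OF \<chi>] contract_left_pure[OF \<chi>] t_closed)
      then have "contract_left \<chi> u' = contract_left \<chi> u \<ominus>\<^bsub>W\<^esub> \<chi> v \<odot>\<^bsub>W\<^esub> w"
        using c u linear_functionals_closed[OF \<chi> v]
        by (simp add: a_minus_def W.M.a_ac W.M.r_neg1 W.M.r_neg2)
      ultimately show ?thesis
        using submodule_minus_closed[OF M insert.prems(3)[OF \<chi>]] by simp
    qed
    then have "u' \<in> psums F M" using insert.IH[OF F u(2)] by blast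
    then have "u' \<in> psums (insert v F) M" by (rule psums_mono) auto
    then show ?thesis using u wM by (auto intro: psums_step)
  qed
qed

text \<open>Left contractions force the second factors into \<open>M\<close>. With these factors
  confined to a finite subset of \<open>M\<close>, the mirrored argument forces the first factors
  into \<open>N\<close> without spoiling the second ones.\<close>

lemma psums_of_contractions_both:
  assumes u: "u \<in> carrier T" and M: "submodule K M W" and N: "submodule K N V"
    and left: "\<And>\<psi>. \<psi> \<in> linear_functionals K V \<Longrightarrow> contract_left \<psi> u \<in> M"
    and right: "\<And>\<phi>. \<phi> \<in> linear_functionals K W \<Longrightarrow>
       tensor_pairing.contract_left K W V T (\<lambda>w v. t v w) \<phi> u \<in> N"
  shows "u \<in> psums N M"
proof -
  interpret S: tensor_pairing K W V T "\<lambda>w v. t v w" by (rule swapped)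
  have MW: "M \<subseteq> carrier W" and NV: "N \<subseteq> carrier V" using M N by (auto simp: submodule_def)
  obtain F where F: "finite F" "F \<subseteq> carrier V" "u \<in> psums F (carrier W)"
    using psums_finite[OF carrier_psums[OF u]] by blast
  then have "u \<in> psums F M" using psums_of_contractions M left by blast
  then have "u \<in> S.psums M (carrier V)"
    using psums_mono F unfolding psums_eq_swapped[symmetric] by blast
  then obtain G where G: "finite G" "G \<subseteq> M" "u \<in> S.psums G (carrier V)"
    using S.psums_finite by blast
  then have "u \<in> S.psums G N" using S.psums_of_contractions[of G N u] MW N right by blast
  then show ?thesis unfolding psums_eq_swapped using S.psums_mono G by blast
qed

text \<open>The bound \<open>B\<close> is the same for every functional; the finiteness argument
  rests on this uniformity.\<close>

lemma contract_left_in_span: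
  assumes B: "B \<subseteq> carrier W" and u: "u \<in> psums (carrier V) B" and \<psi>: "\<psi> \<in> linear_functionals K V"
  shows "contract_left \<psi> u \<in> W.span B"
  using u
proof induction
  interpret S: submodule K "W.span B" W by (rule W.span_is_submodule[OF B])
  case psums_zero
  then show ?case
    using module_hom_zero[OF T.module_axioms W.module_axioms contract_left_hom[OF \<psi>]] by simp
next
  interpret S: submodule K "W.span B" W by (rule W.span_is_submodule[OF B])
  case (psums_step x y u)
  have "y \<in> W.span B" "y \<in> carrier W" "u \<in> carrier T"
    using W.in_own_span[OF B] B psums_step psums_closed by blast+
  then show ?case
    using psums_step linear_functionals_closed[OF \<psi>]
    by (simp add: contract_left_add[OF \<psi>] contract_left_pure[OF \<psi>] t_closed)
qed

end

context tensor_pairing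
begin

text \<open>A functional that is 1 on \<open>v\<close> contracts the pure tensor to
  \<open>w\<close>, so a vanishing tensor would make \<open>w\<close> zero.\<close>

lemma t_nonzero:
  assumes v: "v \<in> carrier V" "v \<noteq> \<zero>\<^bsub>V\<^esub>" and w: "w \<in> carrier W" "w \<noteq> \<zero>\<^bsub>W\<^esub>"
  shows "t v w \<noteq> \<zero>\<^bsub>T\<^esub>"
proof
  assume t0: "t v w = \<zero>\<^bsub>T\<^esub>"
  have "v \<notin> V.span {}" using v by (simp add: V.span_empty)
  then obtain \<psi> where \<psi>: "\<psi> \<in> linear_functionals K V" "\<psi> v = \<one>\<^bsub>K\<^esub>"
    using V.linear_functional_separates[OF V.span_is_submodule[of "{}"] v(1)] by auto
  then have "w = contract_left \<psi> (t v w)" using contract_left_pure[OF \<psi>(1)] v w by simp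
  also have "\<dots> = \<zero>\<^bsub>W\<^esub>"
    using t0 module_hom_zero[OF T.module_axioms W.module_axioms contract_left_hom[OF \<psi>(1)]] by simp
  finally show False using w by simp
qed

lemma psums_subset_submodule:
  assumes N: "submodule K N T" and "\<And>v w. \<lbrakk>v \<in> A; w \<in> B\<rbrakk> \<Longrightarrow> t v w \<in> N"
  shows "psums A B \<subseteq> N"
proof
  interpret N: submodule K N T by (rule N)
  show "u \<in> N" if "u \<in> psums A B" for u
    using that by induction (auto simp: assms)
qed

end

section \<open>Endomorphisms of the form f \<otimes> 1 + 1 \<otimes> g\<close>

locale tensor_derivation = tensor_pairing +
  fixes f g d
  assumes f_hom: "f \<in> module_hom K V V" and g_hom: "g \<in> module_hom K W W"
    and d_closed: "d \<in> carrier T \<rightarrow> carrier T"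
    and d_add: "\<lbrakk>x \<in> carrier T; y \<in> carrier T\<rbrakk> \<Longrightarrow> d (x \<oplus>\<^bsub>T\<^esub> y) = d x \<oplus>\<^bsub>T\<^esub> d y"
    and d_pure: "\<lbrakk>v \<in> carrier V; w \<in> carrier W\<rbrakk> \<Longrightarrow> d (t v w) = t (f v) w \<oplus>\<^bsub>T\<^esub> t v (g w)"
begin

lemma f_closed: "v \<in> carrier V \<Longrightarrow> f v \<in> carrier V"
  using module_hom_closed[OF f_hom] by blast

lemma g_closed: "w \<in> carrier W \<Longrightarrow> g w \<in> carrier W"
  using module_hom_closed[OF g_hom] by blast

lemma d_zero: "d \<zero>\<^bsub>T\<^esub> = \<zero>\<^bsub>T\<^esub>"
proof -
  have "d \<zero>\<^bsub>T\<^esub> \<in> carrier T" using d_closed by auto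
  then show ?thesis using d_add[of "\<zero>\<^bsub>T\<^esub>" "\<zero>\<^bsub>T\<^esub>"] by (simp add: T.M.add.r_cancel_one')
qed

text \<open>Additivity reduces compatibility with scalars to pure tensors, where the scalar is
  carried by the first factor and commutes with \<open>f\<close>.\<close>

lemma d_hom: "d \<in> module_hom K T T"
proof -
  have "d (c \<odot>\<^bsub>T\<^esub> x) = c \<odot>\<^bsub>T\<^esub> d x" if c: "c \<in> carrier K" and x: "x \<in> carrier T" for c x
    using x
  proof (rule t_induct)
    show "d (c \<odot>\<^bsub>T\<^esub> \<zero>\<^bsub>T\<^esub>) = c \<odot>\<^bsub>T\<^esub> d \<zero>\<^bsub>T\<^esub>" using c by (simp add: d_zero)
    show "d (c \<odot>\<^bsub>T\<^esub> t v w) = c \<odot>\<^bsub>T\<^esub> d (t v w)" if "v \<in> carrier V" "w \<in> carrier W" for v w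
      using that c module_hom_smult[OF f_hom c]
      by (simp add: t_smult_left[symmetric] d_pure f_closed g_closed t_closed T.smult_r_distr)
    show "d (c \<odot>\<^bsub>T\<^esub> (x \<oplus>\<^bsub>T\<^esub> y)) = c \<odot>\<^bsub>T\<^esub> d (x \<oplus>\<^bsub>T\<^esub> y)"
      if "x \<in> carrier T" "y \<in> carrier T" "d (c \<odot>\<^bsub>T\<^esub> x) = c \<odot>\<^bsub>T\<^esub> d x" "d (c \<odot>\<^bsub>T\<^esub> y) = c \<odot>\<^bsub>T\<^esub> d y"
      for x y
    proof -
      have "d x \<in> carrier T" "d y \<in> carrier T" using that d_closed by auto
      then show ?thesis using that c by (simp add: T.smult_r_distr d_add)
    qed
  qed
  then show ?thesis using d_closed d_add by (simp add: module_hom_def)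
qed

lemma swapped_derivation: "tensor_derivation K W V T (\<lambda>w v. t v w) g f d"
proof -
  interpret S: tensor_pairing K W V T "\<lambda>w v. t v w" by (rule swapped)
  show ?thesis
    by unfold_locales
      (use d_closed in \<open>auto simp: f_hom g_hom d_add d_pure T.M.a_comm t_closed f_closed g_closed\<close>)
qed

text \<open>On v \<otimes> w the contraction of the image under \<open>d\<close> is \<psi>(f v) w +
  \<psi>(v) g(w), and the second term is \<open>g\<close> of the contraction. Both sides are
  additive, so this settles the general case.\<close>

lemma g_contract_left:
  assumes \<psi>: "\<psi> \<in> linear_functionals K V" and x: "x \<in> carrier T"
  shows "g (contract_left \<psi> x) = contract_left \<psi> (d x) \<ominus>\<^bsub>W\<^esub> contract_left (\<lambda>v. \<psi> (f v)) x"
proof -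
  note \<psi>f = linear_functionals_comp[OF \<psi> f_hom]
  note zero = module_hom_zero[OF T.module_axioms W.module_axioms contract_left_hom]
    module_hom_zero[OF W.module_axioms W.module_axioms g_hom]
  have cl: "contract_left \<chi> y \<in> carrier W" if "\<chi> \<in> linear_functionals K V" "y \<in> carrier T" for \<chi> y
    using module_hom_closed[OF contract_left_hom] that by blast
  have dcl: "d y \<in> carrier T" if "y \<in> carrier T" for y using that d_closed by auto
  have "contract_left \<psi> (d x) = g (contract_left \<psi> x) \<oplus>\<^bsub>W\<^esub> contract_left (\<lambda>v. \<psi> (f v)) x"
    using x
  proof (rule t_induct, goal_cases)
    case 1
    then show ?case using \<psi> \<psi>f by (simp add: d_zero zero)
  next
    case (2 v w)
    then show ?case
      using linear_functionals_closed[OF \<psi>] module_hom_smult[OF g_hom]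
      by (simp add: d_pure contract_left_add[OF \<psi>] contract_left_pure[OF \<psi>]
            contract_left_pure[OF \<psi>f] t_closed f_closed g_closed W.M.a_comm)
  next
    case (3 x y)
    then show ?case
      by (simp add: d_add contract_left_add[OF \<psi>] contract_left_add[OF \<psi>f] dcl cl[OF \<psi>] cl[OF \<psi>f]
            module_hom_add[OF g_hom] g_closed W.M.a_ac)
  qed
  then show ?thesis
    using cl[OF \<psi> x] cl[OF \<psi>f x] by (simp add: a_minus_def W.M.a_assoc W.M.r_neg g_closed)
qed

text \<open>The orbit of \<open>x\<close> lies in sums with second factors from a finite set
  \<open>Y\<close>; repeated use of \<open>g_contract_left\<close> turns powers of \<open>g\<close>
  into contractions of that orbit, which stay in the span of \<open>Y\<close>.\<close>

lemma contract_left_locally_finite: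
  assumes x: "x \<in> locally_finite_part K T d" and \<psi>: "\<psi> \<in> linear_functionals K V"
  shows "contract_left \<psi> x \<in> locally_finite_part K W g"
proof -
  interpret S: tensor_pairing K W V T "\<lambda>w v. t v w" by (rule swapped)
  have xT: "x \<in> carrier T" using x by (simp add: locally_finite_part_def)
  have dn: "(d ^^ n) x \<in> carrier T" for n by (rule T.funpow_closed[OF d_hom xT])
  obtain A where A: "finite A" "A \<subseteq> carrier T" "\<And>n. (d ^^ n) x \<in> T.span A"
    using T.locally_finite_part_span[OF d_hom x] by blast
  have "\<exists>B. finite B \<and> B \<subseteq> carrier W \<and> a \<in> psums (carrier V) B" if "a \<in> A" for a
  proof -
    have "a \<in> carrier T" using A(2) that by blast
    then obtain B where "finite B" "B \<subseteq> carrier W" "a \<in> S.psums B (carrier V)"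
      using S.psums_finite[OF S.carrier_psums] by metis
    then show ?thesis unfolding psums_eq_swapped by blast
  qed
  then obtain B where B: "\<And>a. a \<in> A \<Longrightarrow> finite (B a) \<and> B a \<subseteq> carrier W \<and> a \<in> psums (carrier V) (B a)"
    by metis
  define Y where "Y = (\<Union>a\<in>A. B a)"
  have Y: "finite Y" "Y \<subseteq> carrier W" using A(1) B by (auto simp: Y_def)
  have "A \<subseteq> psums (carrier V) Y"
  proof
    fix a assume "a \<in> A"
    moreover from this have "B a \<subseteq> Y" by (auto simp: Y_def)
    ultimately show "a \<in> psums (carrier V) Y" using B psums_mono by blast
  qed
  moreover have "submodule K (psums (carrier V) Y) T"
    using Y by (intro submodule_psums') (auto simp: submodule_def V.module_axioms)
  \<comment> \<open>The sums with second factors in \<open>Y\<close> form a submodule because the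
    first factors range over all of \<open>V\<close>; it contains the spanning tensors and thus the
    whole orbit.\<close>
  ultimately have dY: "(d ^^ n) x \<in> psums (carrier V) Y" for n
    using A(3) T.span_is_subset by blast
  interpret Y: submodule K "W.span Y" W by (rule W.span_is_submodule[OF Y(2)])
  have cl: "contract_left \<chi> y \<in> carrier W" if "\<chi> \<in> linear_functionals K V" "y \<in> carrier T" for \<chi> y
    using module_hom_closed[OF contract_left_hom] that by blast
  \<comment> \<open>Both \<open>k\<close> and \<chi> are general: one application of
    \<open>g\<close> produces a term further along the orbit and a term with \<chi> o f, so a claim
    about a fixed contraction would not be inductive.\<close>
  have "(g ^^ n) (contract_left \<chi> ((d ^^ k) x)) \<in> W.span Y"
    if "\<chi> \<in> linear_functionals K V" for n k \<chi>
    using that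
  proof (induction n arbitrary: k \<chi>)
    case 0
    then show ?case using contract_left_in_span[OF Y(2) dY] by simp
  next
    case (Suc n)
    note \<chi>f = linear_functionals_comp[OF Suc.prems f_hom]
    have "(g ^^ Suc n) (contract_left \<chi> ((d ^^ k) x))
        = (g ^^ n) (contract_left \<chi> ((d ^^ Suc k) x) \<ominus>\<^bsub>W\<^esub> contract_left (\<lambda>v. \<chi> (f v)) ((d ^^ k) x))"
      using g_contract_left[OF Suc.prems dn] by (simp add: funpow_swap1)
    also have "\<dots> = (g ^^ n) (contract_left \<chi> ((d ^^ Suc k) x))
        \<ominus>\<^bsub>W\<^esub> (g ^^ n) (contract_left (\<lambda>v. \<chi> (f v)) ((d ^^ k) x))"
      using module_hom_minus[OF W.module_axioms W.module_axioms module_hom_funpow[OF g_hom]]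
        cl Suc.prems \<chi>f dn by blast
    also have "\<dots> \<in> W.span Y"
      using submodule_minus_closed[OF Y.submodule_axioms] Suc.IH Suc.prems \<chi>f by blast
    finally show ?case .
  qed
  from this[OF \<psi>, of _ 0] show ?thesis
    using W.locally_finite_partI[OF g_hom cl[OF \<psi> xT] Y] by simp
qed

lemma locally_finite_part_subset_psums:
  assumes "locally_finite_part K V f = nil_part V f" "locally_finite_part K W g = nil_part W g"
  shows "locally_finite_part K T d \<subseteq> psums (nil_part V f) (nil_part W g)"
proof
  interpret S: tensor_derivation K W V T "\<lambda>w v. t v w" g f d by (rule swapped_derivation)
  fix x assume x: "x \<in> locally_finite_part K T d"
  then have "x \<in> carrier T" by (simp add: locally_finite_part_def)
  then show "x \<in> psums (nil_part V f) (nil_part W g)"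
    using V.submodule_nil_part[OF f_hom] W.submodule_nil_part[OF g_hom]
      contract_left_locally_finite[OF x] S.contract_left_locally_finite[OF x] assms
    by (intro psums_of_contractions_both) auto
qed

text \<open>Applying \<open>d\<close> gives two terms, each with one exponent lowered or with a zero
  factor; induction on the sum of the exponents replaces the binomial expansion of powers of
  \<open>d\<close>.\<close>

lemma pure_nilpotent:
  assumes "v \<in> carrier V" "w \<in> carrier W" "(f ^^ m) v = \<zero>\<^bsub>V\<^esub>" "(g ^^ n) w = \<zero>\<^bsub>W\<^esub>"
  shows "t v w \<in> nil_part T d"
  using assms
proof (induction "m + n" arbitrary: m n v w)
  case 0
  \<comment> \<open>Exponents zero mean that both factors vanish.\<close>
  then have "t v w = \<zero>\<^bsub>T\<^esub>"
    using t_smult_left[of "\<zero>\<^bsub>K\<^esub>" v w] t_closed[of v w] by simp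
  then show ?case by (auto simp: nil_part_def intro: exI[of _ 0])
next
  case (Suc k)
  interpret N: submodule K "nil_part T d" T by (rule T.submodule_nil_part[OF d_hom])
  have zero_left: "t \<zero>\<^bsub>V\<^esub> w = \<zero>\<^bsub>T\<^esub>"
    using t_smult_left[of "\<zero>\<^bsub>K\<^esub>" "\<zero>\<^bsub>V\<^esub>" w] Suc.prems t_closed[of "\<zero>\<^bsub>V\<^esub>" w] by simp
  have zero_right: "t v \<zero>\<^bsub>W\<^esub> = \<zero>\<^bsub>T\<^esub>"
    using t_smult_right[of "\<zero>\<^bsub>K\<^esub>" v "\<zero>\<^bsub>W\<^esub>"] Suc.prems t_closed[of v "\<zero>\<^bsub>W\<^esub>"] by simp
  \<comment> \<open>If \<open>m\<close> is 0 then \<open>v\<close> is zero and so is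
    \<open>f v\<close>; otherwise \<open>f v\<close> is killed by one power less.\<close>
  have "t (f v) w \<in> nil_part T d"
  proof (cases m)
    case 0
    then show ?thesis using Suc.prems zero_left
      module_hom_zero[OF V.module_axioms V.module_axioms f_hom] by simp
  next
    case (Suc m')
    then show ?thesis using Suc.hyps(1)[of m' n "f v" w] Suc.hyps(2) Suc.prems
      by (simp add: funpow_swap1 f_closed)
  qed
  moreover have "t v (g w) \<in> nil_part T d"
  proof (cases n)
    case 0
    then show ?thesis using Suc.prems zero_right
      module_hom_zero[OF W.module_axioms W.module_axioms g_hom] by simp
  next
    case (Suc n')
    then show ?thesis using Suc.hyps(1)[of m n' v "g w"] Suc.hyps(2) Suc.prems
      by (simp add: funpow_swap1 g_closed)
  qed
  ultimately have "d (t v w) \<in> nil_part T d" using d_pure Suc.prems by simp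
  then obtain j where "(d ^^ j) (d (t v w)) = \<zero>\<^bsub>T\<^esub>" by (auto simp: nil_part_def)
  then have "(d ^^ Suc j) (t v w) = \<zero>\<^bsub>T\<^esub>" by (simp add: funpow_swap1)
  then show ?case using t_closed Suc.prems unfolding nil_part_def by blast
qed

end

text \<open>The inclusions of F(d) in N(f) \<otimes> N(g), of this in N(d), and of N(d) in F(d)
  close up to a cycle, so all these sets coincide.\<close>

lemma (in tensor_derivation) locally_finite_part_eq:
  assumes F1: "locally_finite_part K V f = nil_part V f" and F2: "locally_finite_part K W g = nil_part W g"
  shows "locally_finite_part K T d = nil_part T d"
    and "nil_part T d = T.span {t v w | v w. v \<in> nil_part V f \<and> w \<in> nil_part W g}"
proof -
  let ?S = "{t v w | v w. v \<in> nil_part V f \<and> w \<in> nil_part W g}"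
  have S: "?S \<subseteq> carrier T" by (auto simp: nil_part_def t_closed)
  have "locally_finite_part K T d \<subseteq> psums (nil_part V f) (nil_part W g)"
    by (rule locally_finite_part_subset_psums[OF F1 F2])
  also have "\<dots> \<subseteq> T.span ?S"
    by (rule psums_subset_submodule[OF T.span_is_submodule[OF S]]) (use T.in_own_span[OF S] in blast)
  also have "\<dots> \<subseteq> nil_part T d"
    by (rule T.span_is_subset[OF _ T.submodule_nil_part[OF d_hom]])
      (auto simp: nil_part_def[of V] nil_part_def[of W] intro: pure_nilpotent)
  finally have 1: "locally_finite_part K T d \<subseteq> nil_part T d" .
  show "locally_finite_part K T d = nil_part T d"
    using 1 T.nil_part_subset_locally_finite_part[OF d_hom] by blast
  show "nil_part T d = T.span ?S"
    using T.nil_part_subset_locally_finite_part[OF d_hom]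
      \<open>locally_finite_part K T d \<subseteq> psums (nil_part V f) (nil_part W g)\<close>
      \<open>psums (nil_part V f) (nil_part W g) \<subseteq> T.span ?S\<close> \<open>T.span ?S \<subseteq> nil_part T d\<close> by blast
qed

section \<open>The tensor product of Poisson algebras\<close>

lemma frag_extend_plus_fun: "frag_extend (\<lambda>p. h p + k p) f = frag_extend h f + frag_extend k f"
  by (rule frag_induction[of f UNIV]) (auto simp: frag_extend_diff)

lemma frag_extend_minus_fun: "frag_extend (\<lambda>p. h p - k p) f = frag_extend h f - frag_extend k f"
  by (rule frag_induction[of f UNIV]) (auto simp: frag_extend_diff)

text \<open>Interchange of a double sum; it allows induction on the second argument of
  \<open>frag_extend2\<close> while the first is kept fixed.\<close>

lemma frag_extend_swap:
  "frag_extend (\<lambda>p. frag_extend (\<lambda>q. h p q) g) f = frag_extend (\<lambda>q. frag_extend (\<lambda>p. h p q) f) g"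
  by (rule frag_induction[of f UNIV]) (auto simp: frag_extend_diff frag_extend_minus_fun frag_extend_eq_0)

lemma frag_extend2_diff_left: "frag_extend2 h (f - f') g = frag_extend2 h f g - frag_extend2 h f' g"
  by (simp add: frag_extend2_def frag_extend_diff)

lemma frag_extend2_diff_right: "frag_extend2 h f (g - g') = frag_extend2 h f g - frag_extend2 h f g'"
  by (simp add: frag_extend2_def frag_extend_diff frag_extend_minus_fun)

lemma frag_extend2_add_left: "frag_extend2 h (f + f') g = frag_extend2 h f g + frag_extend2 h f' g"
  by (simp add: frag_extend2_def frag_extend_add)

lemma frag_extend2_add_right: "frag_extend2 h f (g + g') = frag_extend2 h f g + frag_extend2 h f g'"
  by (simp add: frag_extend2_def frag_extend_add frag_extend_plus_fun)

lemma frag_extend2_of: "frag_extend2 h (frag_of p) (frag_of q) = h p q"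
  by (simp add: frag_extend2_def)

lemma frag_bracket_add_right:
  "frag_bracket P1 P2 f (g + g') = frag_bracket P1 P2 f g + frag_bracket P1 P2 f g'"
  by (simp add: frag_bracket_def frag_mult_def frag_extend2_add_left frag_extend2_add_right)

section \<open>Adjoint maps, multiplications and brackets with the unit\<close>

context nc_poisson_algebra
begin

lemma bracket_hom: "x \<in> carrier P \<Longrightarrow> (\<lambda>y. \<lbrace>x, y\<rbrace>) \<in> module_hom K P P"
  by (auto simp: module_hom_def bracket_closed bracket_add_right bracket_smult_right)

lemma bracket_hom': "y \<in> carrier P \<Longrightarrow> (\<lambda>x. \<lbrace>x, y\<rbrace>) \<in> module_hom K P P"
  by (auto simp: module_hom_def bracket_closed bracket_add_left bracket_smult_left)

lemma mult_hom: "x \<in> carrier P \<Longrightarrow> (\<lambda>y. x \<otimes> y) \<in> module_hom K P P"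
  by (auto simp: module_hom_def alg.r_distr smult_mult_right)

lemma mult_hom': "y \<in> carrier P \<Longrightarrow> (\<lambda>x. x \<otimes> y) \<in> module_hom K P P"
  by (auto simp: module_hom_def alg.l_distr smult_mult_left)

text \<open>The Leibniz rule for the product of the unit with itself gives {x, 1} = {x, 1} + {x,
  1}.\<close>

lemma bracket_one_right:
  assumes "x \<in> carrier P"
  shows "\<lbrace>x, \<one>\<rbrace> = \<zero>"
  using leibniz[of x \<one> \<one>] assms bracket_closed[of x \<one>] by simp

text \<open>The Lie axiom reads {x, x} = 0, so the two sides are exchanged by expanding {1 + x, 1 +
  x} = 0.\<close>

lemma bracket_one_left:
  assumes "x \<in> carrier P"
  shows "\<lbrace>\<one>, x\<rbrace> = \<zero>"
proof -
  have "\<lbrace>\<one> \<oplus> x, \<one> \<oplus> x\<rbrace> = \<lbrace>\<one>, x\<rbrace>"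
    using assms by (simp add: bracket_add_left bracket_add_right bracket_closed
        bracket_self[OF assms] bracket_one_right)
  then show ?thesis using bracket_self[of "\<one> \<oplus> x"] assms by simp
qed

end

section \<open>The quotient of the formal sums by the tensor relations\<close>

locale poisson_pair = P1: nc_poisson_algebra K P1 + P2: nc_poisson_algebra K P2
  for K :: "('k, 'm) ring_scheme" and P1 :: "('k, 'a, 'n1) poisson_scheme"
    and P2 :: "('k, 'b, 'n2) poisson_scheme"
begin

abbreviation FS where "FS \<equiv> formal_sums P1 P2"
abbreviation TN where "TN \<equiv> tensor_null K P1 P2"
abbreviation T where "T \<equiv> tensor_poisson K P1 P2"
abbreviation cls where "cls \<equiv> tensor_class K P1 P2"
abbreviation pure where "pure \<equiv> pure_tensor K P1 P2"

lemma FS_simps: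
  "x \<in> carrier FS \<longleftrightarrow> Poly_Mapping.keys x \<subseteq> carrier P1 \<times> carrier P2"
  "x \<otimes>\<^bsub>FS\<^esub> y = x + y" "\<one>\<^bsub>FS\<^esub> = 0"
  by (simp_all add: formal_sums_def)

lemma FS_comm_group: "comm_group FS"
  by (simp add: formal_sums_def abelian_free_Abelian_group)

lemma relators_closed: "tensor_relators K P1 P2 \<subseteq> carrier FS"
proof -
  have m: "x - y \<in> carrier FS" if "x \<in> carrier FS" "y \<in> carrier FS" for x y
    using that keys_diff[of x y] by (auto simp: FS_simps)
  have "frag_of (a, b) \<in> carrier FS" if "a \<in> carrier P1" "b \<in> carrier P2" for a b
    using that by (simp add: FS_simps)
  then show ?thesis by (auto simp: tensor_relators_def simp del: FS_simps intro!: m)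
qed

lemma TN_subgroup: "subgroup TN FS"
  unfolding tensor_null_def
  by (rule group.generate_is_subgroup[OF comm_group.axioms(2)[OF FS_comm_group] relators_closed])

lemma TN_normal: "TN \<lhd> FS"
  using comm_group.normal_iff_subgroup[OF FS_comm_group] TN_subgroup by blast

lemma TN_closed: "x \<in> TN \<Longrightarrow> x \<in> carrier FS"
  using subgroup.subset[OF TN_subgroup] by blast

lemma TN_zero: "0 \<in> TN"
  using subgroup.one_closed[OF TN_subgroup] by (simp add: FS_simps)

lemma TN_add: "\<lbrakk>x \<in> TN; y \<in> TN\<rbrakk> \<Longrightarrow> x + y \<in> TN"
  using subgroup.m_closed[OF TN_subgroup] by (simp add: FS_simps)

lemma TN_uminus: "x \<in> TN \<Longrightarrow> - x \<in> TN"
  using subgroup.m_inv_closed[OF TN_subgroup, of x] TN_closed[of x]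
  by (simp add: formal_sums_def)

lemma TN_diff: "\<lbrakk>x \<in> TN; y \<in> TN\<rbrakk> \<Longrightarrow> x - y \<in> TN"
  using TN_add[of x "- y"] TN_uminus[of y] by simp

text \<open>One closure rule suffices, since negation is 0 - x and a sum is x - (-y); additive
  extensions preserve differences directly.\<close>

lemma TN_induct [consumes 1, case_names zero relator diff]:
  assumes "x \<in> TN" "Q 0" "\<And>r. r \<in> tensor_relators K P1 P2 \<Longrightarrow> Q r"
    "\<And>x y. \<lbrakk>x \<in> TN; y \<in> TN; Q x; Q y\<rbrakk> \<Longrightarrow> Q (x - y)"
  shows "Q x"
proof -
  have neg: "Q (- x)" if "x \<in> TN" "Q x" for x using assms(4)[OF TN_zero that(1) assms(2) that(2)] by simp
  have rel: "r \<in> TN" if "r \<in> tensor_relators K P1 P2" for r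
    using that by (simp add: tensor_null_def generate.incl)
  have "x \<in> TN \<and> Q x"
    using assms(1) unfolding tensor_null_def
  proof (induction rule: generate.induct)
    case one
    then show ?case using assms(2) TN_zero by (simp add: FS_simps tensor_null_def)
  next
    case (incl h)
    then show ?case using assms(3) rel by (simp add: tensor_null_def)
  next
    case (inv h)
    then have "inv\<^bsub>FS\<^esub> h = - h" using relators_closed
      by (auto simp: formal_sums_def)
    then show ?case using neg rel[OF inv] assms(3)[OF inv] TN_uminus by (simp add: tensor_null_def)
  next
    case (eng h k)
    then show ?case using assms(4)[of h "- k"] neg[of k] TN_uminus[of k] TN_add[of h k]
      by (simp add: tensor_null_def FS_simps)
  qed
  then show ?thesis ..
qed

lemma relator_null:
  "\<lbrakk>a \<in> carrier P1; a' \<in> carrier P1; b \<in> carrier P2\<rbrakk>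
    \<Longrightarrow> frag_of (a \<oplus>\<^bsub>P1\<^esub> a', b) - frag_of (a, b) - frag_of (a', b) \<in> TN"
  "\<lbrakk>a \<in> carrier P1; b \<in> carrier P2; b' \<in> carrier P2\<rbrakk>
    \<Longrightarrow> frag_of (a, b \<oplus>\<^bsub>P2\<^esub> b') - frag_of (a, b) - frag_of (a, b') \<in> TN"
  "\<lbrakk>c \<in> carrier K; a \<in> carrier P1; b \<in> carrier P2\<rbrakk>
    \<Longrightarrow> frag_of (c \<odot>\<^bsub>P1\<^esub> a, b) - frag_of (a, c \<odot>\<^bsub>P2\<^esub> b) \<in> TN"
  unfolding tensor_null_def by (rule generate.incl; auto simp: tensor_relators_def)+

text \<open>The map f \<otimes> g sends each relator to a relator of the same kind. Well-definedness
  of scalar multiplication and of the bracket on classes reduces to this.\<close>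

lemma TN_map:
  assumes f: "f \<in> module_hom K P1 P1" and g: "g \<in> module_hom K P2 P2" and x: "x \<in> TN"
  shows "frag_extend (\<lambda>(a, b). frag_of (f a, g b)) x \<in> TN"
  using x
proof (induction rule: TN_induct)
  case zero
  then show ?case by (simp add: TN_zero)
next
  case (relator r)
  have "f a \<in> carrier P1" if "a \<in> carrier P1" for a using module_hom_closed[OF f] that by blast
  moreover have "g a \<in> carrier P2" if "a \<in> carrier P2" for a using module_hom_closed[OF g] that by blast
  ultimately show ?case using relator unfolding tensor_relators_def
    by (auto simp: frag_extend_diff module_hom_add[OF f] module_hom_add[OF g] module_hom_smult[OF f]
        module_hom_smult[OF g] intro!: relator_null)
next
  case (diff x y)
  then show ?case by (simp add: frag_extend_diff TN_diff)
qed

lemma cls_eq_image: "cls f = (\<lambda>n. n + f) ` TN"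
  by (auto simp: tensor_class_def r_coset_def FS_simps)

lemma cls_eqI:
  assumes "f - g \<in> TN"
  shows "cls f = cls g"
proof -
  have "n + f \<in> cls g" if "n \<in> TN" for n
    using TN_add[OF that assms] unfolding cls_eq_image by (force simp: image_iff)
  moreover have "n + g \<in> cls f" if "n \<in> TN" for n
    using TN_diff[OF that assms] unfolding cls_eq_image by (force simp: image_iff)
  ultimately show ?thesis by (auto simp: cls_eq_image)
qed

lemma cls_memD: "g \<in> cls f \<Longrightarrow> g - f \<in> TN"
  by (auto simp: cls_eq_image)

lemma cls_self: "f \<in> cls f"
  using TN_zero by (force simp: cls_eq_image)

lemma carrier_T: "carrier T = cls ` carrier FS"
  unfolding tensor_poisson_def tensor_class_def by (simp add: carrier_FactGroup)

lemma zero_T: "\<zero>\<^bsub>T\<^esub> = cls 0"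
  by (simp add: tensor_poisson_def cls_eq_image)

lemma cls_add: "cls (f + g) = cls f \<oplus>\<^bsub>T\<^esub> cls g"
proof -
  have "cls f \<oplus>\<^bsub>T\<^esub> cls g = {x + y | x y. x \<in> cls f \<and> y \<in> cls g}"
    by (auto simp: tensor_poisson_def set_mult_def FS_simps)
  also have "\<dots> = cls (f + g)"
  proof (intro equalityI subsetI)
    fix z assume "z \<in> {x + y | x y. x \<in> cls f \<and> y \<in> cls g}"
    then obtain m n where "z = (m + f) + (n + g)" "m \<in> TN" "n \<in> TN" by (auto simp: cls_eq_image)
    then have "z = (m + n) + (f + g)" "m + n \<in> TN" by (simp_all add: TN_add algebra_simps)
    then show "z \<in> cls (f + g)" by (auto simp: cls_eq_image)
  next
    fix z assume "z \<in> cls (f + g)"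
    then obtain n where "z = (n + f) + g" "n + f \<in> cls f" by (auto simp: cls_eq_image add.assoc)
    then show "z \<in> {x + y | x y. x \<in> cls f \<and> y \<in> cls g}"
      using cls_self[of g] by blast
  qed
  finally show ?thesis by simp
qed

lemma cls_closed: "f \<in> carrier FS \<Longrightarrow> cls f \<in> carrier T"
  by (simp add: carrier_T)

lemma T_abelian_group: "abelian_group T"
proof (rule abelian_groupI)
  show "\<zero>\<^bsub>T\<^esub> \<in> carrier T" by (simp add: zero_T cls_closed FS_simps)
next
  fix x y assume "x \<in> carrier T" "y \<in> carrier T"
  then obtain f g where *: "x = cls f" "y = cls g" "f \<in> carrier FS" "g \<in> carrier FS"
    by (auto simp: carrier_T)
  then have "f + g \<in> carrier FS" using keys_add[of f g] by (auto simp: FS_simps)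
  then show "x \<oplus>\<^bsub>T\<^esub> y \<in> carrier T" using * by (simp add: cls_closed flip: cls_add)
  show "x \<oplus>\<^bsub>T\<^esub> y = y \<oplus>\<^bsub>T\<^esub> x" using * by (simp add: add.commute flip: cls_add)
next
  fix x assume "x \<in> carrier T"
  then obtain f where *: "x = cls f" "f \<in> carrier FS" by (auto simp: carrier_T)
  then show "\<zero>\<^bsub>T\<^esub> \<oplus>\<^bsub>T\<^esub> x = x" by (simp add: zero_T flip: cls_add)
  have "- f \<in> carrier FS" using * by (simp add: FS_simps)
  moreover have "cls (- f) \<oplus>\<^bsub>T\<^esub> x = \<zero>\<^bsub>T\<^esub>" using * by (simp add: zero_T flip: cls_add)
  ultimately show "\<exists>y\<in>carrier T. y \<oplus>\<^bsub>T\<^esub> x = \<zero>\<^bsub>T\<^esub>" using cls_closed by blast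
qed (auto simp: carrier_T add.assoc simp flip: cls_add)

section \<open>Pure tensors and induction on tensors\<close>

lemma pure_closed: "\<lbrakk>a \<in> carrier P1; b \<in> carrier P2\<rbrakk> \<Longrightarrow> pure a b \<in> carrier T"
  by (simp add: pure_tensor_def cls_closed FS_simps)

lemma pure_add_left:
  "\<lbrakk>a \<in> carrier P1; a' \<in> carrier P1; b \<in> carrier P2\<rbrakk> \<Longrightarrow> pure (a \<oplus>\<^bsub>P1\<^esub> a') b = pure a b \<oplus>\<^bsub>T\<^esub> pure a' b"
  using cls_eqI[of "frag_of (a \<oplus>\<^bsub>P1\<^esub> a', b)" "frag_of (a, b) + frag_of (a', b)"] relator_null(1)[of a a' b]
  by (simp add: pure_tensor_def cls_add algebra_simps)

lemma pure_add_right: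
  "\<lbrakk>a \<in> carrier P1; b \<in> carrier P2; b' \<in> carrier P2\<rbrakk> \<Longrightarrow> pure a (b \<oplus>\<^bsub>P2\<^esub> b') = pure a b \<oplus>\<^bsub>T\<^esub> pure a b'"
  using cls_eqI[of "frag_of (a, b \<oplus>\<^bsub>P2\<^esub> b')" "frag_of (a, b) + frag_of (a, b')"] relator_null(2)[of a b b']
  by (simp add: pure_tensor_def cls_add algebra_simps)

lemma pure_smult_swap:
  "\<lbrakk>c \<in> carrier K; a \<in> carrier P1; b \<in> carrier P2\<rbrakk> \<Longrightarrow> pure (c \<odot>\<^bsub>P1\<^esub> a) b = pure a (c \<odot>\<^bsub>P2\<^esub> b)"
  unfolding pure_tensor_def by (rule cls_eqI) (rule relator_null)

lemma pure_zero_left: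
  assumes "b \<in> carrier P2"
  shows "pure \<zero>\<^bsub>P1\<^esub> b = \<zero>\<^bsub>T\<^esub>"
proof -
  interpret T: abelian_group T by (rule T_abelian_group)
  show ?thesis
    using pure_add_left[of "\<zero>\<^bsub>P1\<^esub>" "\<zero>\<^bsub>P1\<^esub>" b] pure_closed[of "\<zero>\<^bsub>P1\<^esub>" b] assms
    by (simp add: T.add.r_cancel_one')
qed

lemma pure_zero_right:
  assumes "a \<in> carrier P1"
  shows "pure a \<zero>\<^bsub>P2\<^esub> = \<zero>\<^bsub>T\<^esub>"
proof -
  interpret T: abelian_group T by (rule T_abelian_group)
  show ?thesis
    using pure_add_right[of a "\<zero>\<^bsub>P2\<^esub>" "\<zero>\<^bsub>P2\<^esub>"] pure_closed[of a "\<zero>\<^bsub>P2\<^esub>"] assms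
    by (simp add: T.add.r_cancel_one')
qed

lemma cls_uminus:
  assumes "f \<in> carrier FS"
  shows "cls (- f) = \<ominus>\<^bsub>T\<^esub> cls f"
proof -
  interpret T: abelian_group T by (rule T_abelian_group)
  have "- f \<in> carrier FS" using assms by (simp add: FS_simps)
  moreover have "cls (- f) \<oplus>\<^bsub>T\<^esub> cls f = \<zero>\<^bsub>T\<^esub>" by (simp flip: cls_add add: zero_T)
  ultimately show ?thesis using assms cls_closed T.minus_equality by metis
qed

lemma pure_uminus_left:
  assumes "a \<in> carrier P1" "b \<in> carrier P2"
  shows "pure (\<ominus>\<^bsub>P1\<^esub> a) b = \<ominus>\<^bsub>T\<^esub> pure a b"
proof -
  interpret T: abelian_group T by (rule T_abelian_group)
  have "pure (\<ominus>\<^bsub>P1\<^esub> a) b \<oplus>\<^bsub>T\<^esub> pure a b = \<zero>\<^bsub>T\<^esub>"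
    using assms by (simp flip: pure_add_left add: P1.M.l_neg pure_zero_left)
  then show ?thesis using assms pure_closed T.minus_equality by (metis P1.M.a_inv_closed)
qed

lemma pure_uminus_right:
  assumes "a \<in> carrier P1" "b \<in> carrier P2"
  shows "pure a (\<ominus>\<^bsub>P2\<^esub> b) = \<ominus>\<^bsub>T\<^esub> pure a b"
proof -
  interpret T: abelian_group T by (rule T_abelian_group)
  have "pure a (\<ominus>\<^bsub>P2\<^esub> b) \<oplus>\<^bsub>T\<^esub> pure a b = \<zero>\<^bsub>T\<^esub>"
    using assms by (simp flip: pure_add_right add: P2.M.l_neg pure_zero_right)
  then show ?thesis using assms pure_closed T.minus_equality by (metis P2.M.a_inv_closed)
qed

text \<open>A formal sum has integer coefficients, yet no rule for negation is demanded of
  \<open>Q\<close>: minus a pure tensor is again pure, with -a in place of a.\<close>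

lemma tensor_induct [consumes 1, case_names zero pure add]:
  assumes x: "x \<in> carrier T" and zero: "Q \<zero>\<^bsub>T\<^esub>"
    and pure: "\<And>a b. \<lbrakk>a \<in> carrier P1; b \<in> carrier P2\<rbrakk> \<Longrightarrow> Q (pure a b)"
    and add: "\<And>x y. \<lbrakk>x \<in> carrier T; y \<in> carrier T; Q x; Q y\<rbrakk> \<Longrightarrow> Q (x \<oplus>\<^bsub>T\<^esub> y)"
  shows "Q x"
proof -
  obtain f where f: "x = cls f" "Poly_Mapping.keys f \<subseteq> carrier P1 \<times> carrier P2"
    using x by (auto simp: carrier_T FS_simps)
  let ?R = "\<lambda>x. x \<in> carrier T \<and> Q x"
  have sum: "?R (cls (f + g))" if "?R (cls f)" "?R (cls g)" for f g
    using that add abelian_group.axioms(1)[OF T_abelian_group] abelian_monoid.a_closed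
    unfolding cls_add by metis
  \<comment> \<open>Carrying the claim for -f along turns the difference rule of
    \<open>frag_induction\<close> into two sums.\<close>
  have "?R (cls f) \<and> ?R (cls (- f))"
    using f(2)
  proof (induction rule: frag_induction)
    case zero
    then show ?case using assms(2) cls_closed[of 0] by (simp add: zero_T FS_simps)
  next
    case (one p)
    obtain a b where p: "p = (a, b)" "a \<in> carrier P1" "b \<in> carrier P2" using one by auto
    have "cls (- frag_of p) = pure (\<ominus>\<^bsub>P1\<^esub> a) b"
      using p by (simp add: pure_uminus_left) (simp add: pure_tensor_def cls_uminus FS_simps)
    moreover have "cls (frag_of p) = pure a b" by (simp add: pure_tensor_def p)
    ultimately show ?case using p by (simp add: pure pure_closed)
  next
    case (diff f g)
    then show ?case using sum[of f "- g"] sum[of "- f" g] by simp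
  qed
  then show ?thesis using f by simp
qed

text \<open>All cosets in the defining union coincide, since scaling the first factor preserves the
  null subgroup.\<close>

lemma smult_cls:
  assumes "c \<in> carrier K"
  shows "c \<odot>\<^bsub>T\<^esub> cls f = cls (frag_smult P1 c f)"
proof -
  have "cls (frag_smult P1 c g) = cls (frag_smult P1 c f)" if "g \<in> cls f" for g
  proof (rule cls_eqI)
    have "(\<lambda>x. c \<odot>\<^bsub>P1\<^esub> x) \<in> module_hom K P1 P1"
      using assms by (auto simp: module_hom_def P1.smult_r_distr P1.R.m_comm
          simp flip: P1.smult_assoc1)
    moreover have "(\<lambda>x. x) \<in> module_hom K P2 P2" by (simp add: module_hom_def)
    ultimately have "frag_smult P1 c (g - f) \<in> TN"
      unfolding frag_smult_def using TN_map cls_memD[OF that] by blast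
    then show "frag_smult P1 c g - frag_smult P1 c f \<in> TN"
      by (simp add: frag_smult_def frag_extend_diff)
  qed
  then have "(\<Union>g\<in>cls f. cls (frag_smult P1 c g)) = cls (frag_smult P1 c f)"
    by (intro UN_constant_eq[OF cls_self] ballI)
  then show ?thesis by (simp add: tensor_poisson_def)
qed

lemma smult_pure:
  assumes "c \<in> carrier K"
  shows "c \<odot>\<^bsub>T\<^esub> pure a b = pure (c \<odot>\<^bsub>P1\<^esub> a) b"
  by (simp add: pure_tensor_def smult_cls assms frag_smult_def)

lemma smult_T_add:
  assumes "c \<in> carrier K" "x \<in> carrier T" "y \<in> carrier T"
  shows "c \<odot>\<^bsub>T\<^esub> (x \<oplus>\<^bsub>T\<^esub> y) = c \<odot>\<^bsub>T\<^esub> x \<oplus>\<^bsub>T\<^esub> c \<odot>\<^bsub>T\<^esub> y"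
  using assms by (auto simp: carrier_T smult_cls frag_smult_def frag_extend_add simp flip: cls_add)

lemma smult_T_zero: "c \<in> carrier K \<Longrightarrow> c \<odot>\<^bsub>T\<^esub> \<zero>\<^bsub>T\<^esub> = \<zero>\<^bsub>T\<^esub>"
  by (simp add: zero_T smult_cls frag_smult_def)

text \<open>The axioms in a single tensor are checked on pure tensors, where they are inherited from
  the first factor.\<close>

lemma T_vectorspace: "vectorspace K T"
proof -
  interpret T: abelian_group T by (rule T_abelian_group)
  have closed: "c \<odot>\<^bsub>T\<^esub> x \<in> carrier T" if "c \<in> carrier K" "x \<in> carrier T" for c x
    using that(2) by (induction rule: tensor_induct)
      (simp_all add: that(1) smult_T_zero smult_pure pure_closed smult_T_add)
  have "module K T"
  proof (rule moduleI)
    fix c d x assume cd: "c \<in> carrier K" "d \<in> carrier K" and x: "x \<in> carrier T"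
    show "(c \<oplus>\<^bsub>K\<^esub> d) \<odot>\<^bsub>T\<^esub> x = c \<odot>\<^bsub>T\<^esub> x \<oplus>\<^bsub>T\<^esub> d \<odot>\<^bsub>T\<^esub> x"
      using x by (induction rule: tensor_induct)
        (simp_all add: cd smult_T_zero smult_pure P1.smult_l_distr pure_add_left smult_T_add closed T.a_ac)
    show "(c \<otimes>\<^bsub>K\<^esub> d) \<odot>\<^bsub>T\<^esub> x = c \<odot>\<^bsub>T\<^esub> (d \<odot>\<^bsub>T\<^esub> x)"
      using x by (induction rule: tensor_induct)
        (simp_all add: cd smult_T_zero smult_pure P1.smult_assoc1 smult_T_add closed)
  next
    fix x assume "x \<in> carrier T"
    then show "\<one>\<^bsub>K\<^esub> \<odot>\<^bsub>T\<^esub> x = x"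
      by (induction rule: tensor_induct) (simp_all add: smult_T_zero smult_pure smult_T_add)
  qed (simp_all add: closed smult_T_add P1.R.cring_axioms T_abelian_group)
  then show ?thesis using P1.field_axioms by (simp add: vectorspace_def)
qed

text \<open>\<beta> extends to the free abelian group, kills the three kinds of relators and so
  factors through the quotient. This only yields a group homomorphism; compatibility with scalars is
  recovered by induction on tensors.\<close>

lemma tensor_universal:
  assumes M: "module K M"
    and \<beta>_closed: "\<And>a b. \<lbrakk>a \<in> carrier P1; b \<in> carrier P2\<rbrakk> \<Longrightarrow> \<beta> a b \<in> carrier M"
    and \<beta>_add_left: "\<And>a a' b. \<lbrakk>a \<in> carrier P1; a' \<in> carrier P1; b \<in> carrier P2\<rbrakk>
      \<Longrightarrow> \<beta> (a \<oplus>\<^bsub>P1\<^esub> a') b = \<beta> a b \<oplus>\<^bsub>M\<^esub> \<beta> a' b"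
    and \<beta>_add_right: "\<And>a b b'. \<lbrakk>a \<in> carrier P1; b \<in> carrier P2; b' \<in> carrier P2\<rbrakk>
      \<Longrightarrow> \<beta> a (b \<oplus>\<^bsub>P2\<^esub> b') = \<beta> a b \<oplus>\<^bsub>M\<^esub> \<beta> a b'"
    and \<beta>_smult_left: "\<And>c a b. \<lbrakk>c \<in> carrier K; a \<in> carrier P1; b \<in> carrier P2\<rbrakk>
      \<Longrightarrow> \<beta> (c \<odot>\<^bsub>P1\<^esub> a) b = c \<odot>\<^bsub>M\<^esub> \<beta> a b"
    and \<beta>_smult_right: "\<And>c a b. \<lbrakk>c \<in> carrier K; a \<in> carrier P1; b \<in> carrier P2\<rbrakk>
      \<Longrightarrow> \<beta> a (c \<odot>\<^bsub>P2\<^esub> b) = c \<odot>\<^bsub>M\<^esub> \<beta> a b"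
  shows "\<exists>L\<in>module_hom K T M. \<forall>a\<in>carrier P1. \<forall>b\<in>carrier P2. L (pure a b) = \<beta> a b"
proof -
  interpret M: module K M by (rule M)
  interpret T: vectorspace K T by (rule T_vectorspace)
  have "case_prod \<beta> ` (carrier P1 \<times> carrier P2) \<subseteq> carrier (add_monoid M)"
    using \<beta>_closed by auto
  then obtain h where h: "h \<in> hom FS (add_monoid M)"
    and h_of: "\<And>a b. \<lbrakk>a \<in> carrier P1; b \<in> carrier P2\<rbrakk> \<Longrightarrow> h (frag_of (a, b)) = \<beta> a b"
    using comm_group.free_Abelian_group_universal[OF M.M.a_comm_group, of "case_prod \<beta>" "carrier P1 \<times> carrier P2"]
    unfolding formal_sums_def by (metis (no_types, lifting) SigmaI case_prod_conv)
  interpret h: group_hom FS "add_monoid M" h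
    using h FS_comm_group M.M.a_group
    by (simp add: group_hom_def group_hom_axioms_def comm_group.axioms(2))
  have h_diff: "h (x - y) = h x \<ominus>\<^bsub>M\<^esub> h y" if "x \<in> carrier FS" "y \<in> carrier FS" for x y
  proof -
    have "x - y = x \<otimes>\<^bsub>FS\<^esub> inv\<^bsub>FS\<^esub> y" using that by (simp add: formal_sums_def)
    then show ?thesis using that h.hom_mult[of x "inv\<^bsub>FS\<^esub> y"] h.hom_inv[of y]
      by (simp add: a_minus_def a_inv_def)
  qed
  have of_closed: "frag_of (a, b) \<in> carrier FS" if "a \<in> carrier P1" "b \<in> carrier P2" for a b
    using that by (simp add: FS_simps)
  have diff_closed: "x - y \<in> carrier FS" if "x \<in> carrier FS" "y \<in> carrier FS" for x y
    using that keys_diff[of x y] by (auto simp: FS_simps)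
  have cancel: "(x \<oplus>\<^bsub>M\<^esub> y) \<ominus>\<^bsub>M\<^esub> x \<ominus>\<^bsub>M\<^esub> y = \<zero>\<^bsub>M\<^esub>" if "x \<in> carrier M" "y \<in> carrier M" for x y
  proof -
    have "(x \<oplus>\<^bsub>M\<^esub> y) \<ominus>\<^bsub>M\<^esub> x \<ominus>\<^bsub>M\<^esub> y = (x \<oplus>\<^bsub>M\<^esub> y) \<ominus>\<^bsub>M\<^esub> (x \<oplus>\<^bsub>M\<^esub> y)"
      using that by (simp add: a_minus_def M.M.minus_add M.M.a_ac)
    then show ?thesis using that by (simp add: a_minus_def M.M.r_neg)
  qed
  have h_null: "h x = \<zero>\<^bsub>M\<^esub>" if "x \<in> TN" for x
    using that
  proof (induction rule: TN_induct)
    case zero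
    then show ?case using h.hom_one by (simp add: FS_simps)
  next
    case (relator r)
    then show ?case unfolding tensor_relators_def
      by (auto simp: h_diff diff_closed of_closed h_of \<beta>_closed \<beta>_add_left \<beta>_add_right
          \<beta>_smult_left \<beta>_smult_right cancel)
  next
    case (diff x y)
    then show ?case by (simp add: h_diff TN_closed a_minus_def M.M.r_neg)
  qed
  have "TN \<subseteq> kernel FS (add_monoid M) h" using h_null TN_closed by (auto simp: kernel_def)
  then obtain L where L: "L \<in> hom (FS Mod TN) (add_monoid M)"
    and L_cls: "\<And>x. x \<in> carrier FS \<Longrightarrow> L (TN #>\<^bsub>FS\<^esub> x) = h x"
    using h.FactGroup_universal_kernel[OF TN_normal] by blast
  have L_closed: "L x \<in> carrier M" if "x \<in> carrier T" for x
    using that L by (auto simp: tensor_poisson_def hom_def)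
  have L_add: "L (x \<oplus>\<^bsub>T\<^esub> y) = L x \<oplus>\<^bsub>M\<^esub> L y" if "x \<in> carrier T" "y \<in> carrier T" for x y
    using that hom_mult[OF L, of x y] by (simp add: tensor_poisson_def)
  have L_pure: "L (pure a b) = \<beta> a b" if "a \<in> carrier P1" "b \<in> carrier P2" for a b
    using L_cls[OF of_closed[OF that]] that by (simp add: pure_tensor_def tensor_class_def h_of)
  have L_zero: "L \<zero>\<^bsub>T\<^esub> = \<zero>\<^bsub>M\<^esub>"
    using L_add[of "\<zero>\<^bsub>T\<^esub>" "\<zero>\<^bsub>T\<^esub>"] L_closed[of "\<zero>\<^bsub>T\<^esub>"] by (simp add: M.M.add.r_cancel_one')
  have "L (c \<odot>\<^bsub>T\<^esub> x) = c \<odot>\<^bsub>M\<^esub> L x" if "c \<in> carrier K" "x \<in> carrier T" for c x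
    using that(2)
    by (induction rule: tensor_induct)
      (simp_all add: that(1) L_zero smult_pure L_pure \<beta>_smult_left T.smult_r_distr L_add
        M.smult_r_distr L_closed)
  then have "L \<in> module_hom K T M" using L_closed L_add by (auto simp: module_hom_def)
  then show ?thesis using L_pure by blast
qed

text \<open>The contractions come from the universal property applied to the bilinear maps sending
  (a, b) to \<psi>(a) b and to \<phi>(b) a.\<close>

lemma T_pairing: "tensor_pairing K P1 P2 T pure"
proof -
  interpret T: vectorspace K T by (rule T_vectorspace)
  show ?thesis
  proof (unfold_locales, goal_cases)
    case (6 Q x)
    then show ?case using tensor_induct[of x Q] by blast
  next
    case (7 \<psi>)
    show ?case
      using linear_functionals_closed[OF 7] linear_functionals_add[OF 7] linear_functionals_smult[OF 7]
      by (intro tensor_universal P2.module_axioms)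
        (simp_all add: P2.smult_l_distr P2.smult_r_distr P1.R.m_comm flip: P2.smult_assoc1)
  next
    case (8 \<phi>)
    show ?case
      using linear_functionals_closed[OF 8] linear_functionals_add[OF 8] linear_functionals_smult[OF 8]
      by (intro tensor_universal P1.module_axioms)
        (simp_all add: P1.smult_l_distr P1.smult_r_distr P1.R.m_comm flip: P1.smult_assoc1)
  qed (simp_all add: pure_closed pure_add_left pure_add_right smult_pure pure_smult_swap[symmetric])
qed

text \<open>The change of both arguments splits as h(f - f', g) + h(f', g - g'), so that only one
  argument at a time is null.\<close>

lemma TN_extend2:
  assumes right: "\<And>p x. \<lbrakk>p \<in> carrier P1 \<times> carrier P2; x \<in> TN\<rbrakk> \<Longrightarrow> frag_extend (h p) x \<in> TN"
    and left: "\<And>q x. \<lbrakk>q \<in> carrier P1 \<times> carrier P2; x \<in> TN\<rbrakk> \<Longrightarrow> frag_extend (\<lambda>p. h p q) x \<in> TN"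
    and "f - f' \<in> TN" "g - g' \<in> TN" "f' \<in> carrier FS" "g \<in> carrier FS"
  shows "frag_extend2 h f g - frag_extend2 h f' g' \<in> TN"
proof -
  have r: "frag_extend2 h f x \<in> TN"
    if "Poly_Mapping.keys f \<subseteq> carrier P1 \<times> carrier P2" "x \<in> TN" for f x
    unfolding frag_extend2_def using that(1)
    by (induction rule: frag_induction)
      (use right that(2) in \<open>auto simp: TN_zero frag_extend_diff intro: TN_diff\<close>)
  have l: "frag_extend2 h x g \<in> TN"
    if "Poly_Mapping.keys g \<subseteq> carrier P1 \<times> carrier P2" "x \<in> TN" for g x
    unfolding frag_extend2_def frag_extend_swap[of h g x] using that(1)
    by (induction rule: frag_induction)
      (use left that(2) in \<open>auto simp: TN_zero frag_extend_diff intro: TN_diff\<close>)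
  have "frag_extend2 h (f - f') g + frag_extend2 h f' (g - g') \<in> TN"
    using assms l r by (intro TN_add) (auto simp: FS_simps)
  then show ?thesis by (simp add: frag_extend2_diff_left frag_extend2_diff_right)
qed

lemma frag_mult_null:
  assumes "f - f' \<in> TN" "g - g' \<in> TN" "f' \<in> carrier FS" "g \<in> carrier FS"
  shows "frag_mult P1 P2 f g - frag_mult P1 P2 f' g' \<in> TN"
  unfolding frag_mult_def
proof (rule TN_extend2[OF _ _ assms])
  fix p x assume p: "p \<in> carrier P1 \<times> carrier P2" and x: "x \<in> TN"
  obtain a b where ab: "p = (a, b)" "a \<in> carrier P1" "b \<in> carrier P2" using p by auto
  show "frag_extend (case p of (a1, a2) \<Rightarrow> \<lambda>(b1, b2). frag_of (a1 \<otimes>\<^bsub>P1\<^esub> b1, a2 \<otimes>\<^bsub>P2\<^esub> b2)) x \<in> TN"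
    using TN_map[OF P1.mult_hom[OF ab(2)] P2.mult_hom[OF ab(3)] x] by (simp add: ab(1))
  show "frag_extend (\<lambda>q. (case q of (a1, a2) \<Rightarrow> \<lambda>(b1, b2). frag_of (a1 \<otimes>\<^bsub>P1\<^esub> b1, a2 \<otimes>\<^bsub>P2\<^esub> b2)) p) x \<in> TN"
    using TN_map[OF P1.mult_hom'[OF ab(2)] P2.mult_hom'[OF ab(3)] x]
    by (simp add: ab(1) case_prod_unfold)
qed

text \<open>In each argument the Class 1 formula is a sum of two maps of the form f \<otimes> g,
  built from a multiplication and a bracket with a fixed element; the commutator is a difference of
  two instances of the product case.\<close>

lemma frag_bracket_null:
  assumes "f - f' \<in> TN" "g - g' \<in> TN" "f \<in> carrier FS" "f' \<in> carrier FS" "g \<in> carrier FS" "g' \<in> carrier FS"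
  shows "frag_bracket P1 P2 f g - frag_bracket P1 P2 f' g' \<in> TN"
proof (cases "class1 P1 \<and> class1 P2")
  case True
  let ?h = "\<lambda>(a1, a2) (b1, b2). frag_of (\<lbrace>a1, b1\<rbrace>\<^bsub>P1\<^esub>, a2 \<otimes>\<^bsub>P2\<^esub> b2) + frag_of (b1 \<otimes>\<^bsub>P1\<^esub> a1, \<lbrace>a2, b2\<rbrace>\<^bsub>P2\<^esub>)"
  have "frag_extend2 ?h f g - frag_extend2 ?h f' g' \<in> TN"
  proof (rule TN_extend2[OF _ _ assms(1,2,4,5)])
    fix p x assume p: "p \<in> carrier P1 \<times> carrier P2" and x: "x \<in> TN"
    obtain a b where ab: "p = (a, b)" "a \<in> carrier P1" "b \<in> carrier P2" using p by auto
    show "frag_extend (?h p) x \<in> TN"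
      using TN_add[OF TN_map[OF P1.bracket_hom[OF ab(2)] P2.mult_hom[OF ab(3)] x]
          TN_map[OF P1.mult_hom'[OF ab(2)] P2.bracket_hom[OF ab(3)] x]]
      by (simp add: ab(1) case_prod_unfold frag_extend_plus_fun)
    show "frag_extend (\<lambda>q. ?h q p) x \<in> TN"
      using TN_add[OF TN_map[OF P1.bracket_hom'[OF ab(2)] P2.mult_hom'[OF ab(3)] x]
          TN_map[OF P1.mult_hom[OF ab(2)] P2.bracket_hom'[OF ab(3)] x]]
      by (simp add: ab(1) case_prod_unfold frag_extend_plus_fun)
  qed
  then show ?thesis using True by (simp add: frag_bracket_def)
next
  case False
  have "(frag_mult P1 P2 f g - frag_mult P1 P2 f' g') - (frag_mult P1 P2 g f - frag_mult P1 P2 g' f') \<in> TN"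
    using assms by (intro TN_diff[OF frag_mult_null frag_mult_null])
  moreover have "frag_bracket P1 P2 x y = frag_mult P1 P2 x y - frag_mult P1 P2 y x" for x y
    using False by (auto simp: frag_bracket_def)
  moreover have "a - b - (c - d) = (a - c) - (b - d)" for a b c d :: "('a \<times> 'b) \<Rightarrow>\<^sub>0 int"
    by simp
  ultimately show ?thesis by metis
qed

section \<open>The bracket on classes and the adjoint map of \<Gamma>\<close>

lemma cls_mem_closed: "\<lbrakk>g \<in> cls f; f \<in> carrier FS\<rbrakk> \<Longrightarrow> g \<in> carrier FS"
  using TN_closed comm_group.axioms(2)[OF FS_comm_group] group.subgroup_self subgroup.m_closed
  by (fastforce simp: cls_eq_image FS_simps(2)[symmetric])

lemma bracket_cls:
  assumes "f \<in> carrier FS" "g \<in> carrier FS"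
  shows "\<lbrace>cls f, cls g\<rbrace>\<^bsub>T\<^esub> = cls (frag_bracket P1 P2 f g)"
proof -
  have eq: "cls (frag_bracket P1 P2 f' g') = cls (frag_bracket P1 P2 f g)"
    if "f' \<in> cls f" "g' \<in> cls g" for f' g'
    using that assms cls_memD cls_mem_closed by (intro cls_eqI frag_bracket_null) blast+
  have "(\<Union>f'\<in>cls f. \<Union>g'\<in>cls g. cls (frag_bracket P1 P2 f' g')) = cls (frag_bracket P1 P2 f g)"
    by (intro UN_constant_eq[OF cls_self] ballI eq)
  then show ?thesis by (simp add: tensor_poisson_def)
qed

definition tensor_gamma :: "'a \<Rightarrow> 'b \<Rightarrow> (('a \<times> 'b) \<Rightarrow>\<^sub>0 int) set" where
  "tensor_gamma z1 z2 = pure z1 \<one>\<^bsub>P2\<^esub> \<oplus>\<^bsub>T\<^esub> pure \<one>\<^bsub>P1\<^esub> z2"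

lemma tensor_gamma_cls: "tensor_gamma z1 z2 = cls (frag_of (z1, \<one>\<^bsub>P2\<^esub>) + frag_of (\<one>\<^bsub>P1\<^esub>, z2))"
  by (simp add: tensor_gamma_def cls_add pure_tensor_def)

lemma gamma_rep_closed:
  assumes "z1 \<in> carrier P1" "z2 \<in> carrier P2"
  shows "frag_of (z1, \<one>\<^bsub>P2\<^esub>) + frag_of (\<one>\<^bsub>P1\<^esub>, z2) \<in> carrier FS"
  using assms keys_add[of "frag_of (z1, \<one>\<^bsub>P2\<^esub>)" "frag_of (\<one>\<^bsub>P1\<^esub>, z2)"]
  by (auto simp: FS_simps)

lemma ad_gamma_add:
  assumes "z1 \<in> carrier P1" "z2 \<in> carrier P2" "x \<in> carrier T" "y \<in> carrier T"
  shows "ad T (tensor_gamma z1 z2) (x \<oplus>\<^bsub>T\<^esub> y) = ad T (tensor_gamma z1 z2) x \<oplus>\<^bsub>T\<^esub> ad T (tensor_gamma z1 z2) y"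
proof -
  obtain f g where fg: "x = cls f" "y = cls g" "f \<in> carrier FS" "g \<in> carrier FS"
    using assms by (auto simp: carrier_T)
  have "f + g \<in> carrier FS" using fg keys_add[of f g] by (auto simp: FS_simps)
  then show ?thesis
    using fg gamma_rep_closed[OF assms(1,2)]
    by (simp add: ad_def tensor_gamma_cls bracket_cls frag_bracket_add_right flip: cls_add)
qed

text \<open>In Class 1 the two cross terms carry a bracket with the unit and vanish. In Class 2 the
  four products regroup: multiplying by the unit leaves one commutator in each factor.\<close>

lemma ad_gamma_pure:
  assumes cl: "(class1 P1 \<and> class1 P2) \<or> (class2 P1 \<and> class2 P2)"
    and z: "z1 \<in> carrier P1" "z2 \<in> carrier P2" and ab: "a \<in> carrier P1" "b \<in> carrier P2"
  shows "ad T (tensor_gamma z1 z2) (pure a b) = pure (ad P1 z1 a) b \<oplus>\<^bsub>T\<^esub> pure a (ad P2 z2 b)"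
proof -
  interpret T: vectorspace K T by (rule T_vectorspace)
  let ?\<gamma> = "frag_of (z1, \<one>\<^bsub>P2\<^esub>) + frag_of (\<one>\<^bsub>P1\<^esub>, z2)"
  have abc: "frag_of (a, b) \<in> carrier FS" using ab by (simp add: FS_simps)
  have br: "ad T (tensor_gamma z1 z2) (pure a b) = cls (frag_bracket P1 P2 ?\<gamma> (frag_of (a, b)))"
    using bracket_cls[OF gamma_rep_closed[OF z] abc] by (simp add: ad_def tensor_gamma_cls pure_tensor_def)
  show ?thesis
    using cl
  proof
    assume c1: "class1 P1 \<and> class1 P2"
    have "ad T (tensor_gamma z1 z2) (pure a b) =
      (pure \<lbrace>z1, a\<rbrace>\<^bsub>P1\<^esub> (\<one>\<^bsub>P2\<^esub> \<otimes>\<^bsub>P2\<^esub> b) \<oplus>\<^bsub>T\<^esub> pure (a \<otimes>\<^bsub>P1\<^esub> z1) \<lbrace>\<one>\<^bsub>P2\<^esub>, b\<rbrace>\<^bsub>P2\<^esub>) \<oplus>\<^bsub>T\<^esub>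
      (pure \<lbrace>\<one>\<^bsub>P1\<^esub>, a\<rbrace>\<^bsub>P1\<^esub> (z2 \<otimes>\<^bsub>P2\<^esub> b) \<oplus>\<^bsub>T\<^esub> pure (a \<otimes>\<^bsub>P1\<^esub> \<one>\<^bsub>P1\<^esub>) \<lbrace>z2, b\<rbrace>\<^bsub>P2\<^esub>)"
      unfolding br using c1
      by (simp add: frag_bracket_def frag_extend2_add_left frag_extend2_of pure_tensor_def cls_add)
    then show ?thesis
      using z ab by (simp add: P1.bracket_one_left P2.bracket_one_left pure_zero_left pure_zero_right
          pure_closed P1.bracket_closed P2.bracket_closed ad_def)
  next
    assume c2: "class2 P1 \<and> class2 P2"
    \<comment> \<open>Class 2 excludes Class 1, so \<open>frag_bracket\<close> takes its commutator
      branch.\<close>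
    then have nc: "\<not> class1 P1" by (auto simp: class1_def class2_def)
    have d: "cls (f - g) = cls f \<ominus>\<^bsub>T\<^esub> cls g" if "g \<in> carrier FS" for f g
      using cls_add[of f "- g"] cls_uminus[OF that] by (simp add: a_minus_def)
    have "frag_of (a \<otimes>\<^bsub>P1\<^esub> z1, b \<otimes>\<^bsub>P2\<^esub> \<one>\<^bsub>P2\<^esub>) + frag_of (a \<otimes>\<^bsub>P1\<^esub> \<one>\<^bsub>P1\<^esub>, b \<otimes>\<^bsub>P2\<^esub> z2) \<in> carrier FS"
      using z ab keys_add[of "frag_of (a \<otimes>\<^bsub>P1\<^esub> z1, b \<otimes>\<^bsub>P2\<^esub> \<one>\<^bsub>P2\<^esub>)" "frag_of (a \<otimes>\<^bsub>P1\<^esub> \<one>\<^bsub>P1\<^esub>, b \<otimes>\<^bsub>P2\<^esub> z2)"]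
      by (auto simp: FS_simps)
    then have "ad T (tensor_gamma z1 z2) (pure a b) =
      (pure (z1 \<otimes>\<^bsub>P1\<^esub> a) (\<one>\<^bsub>P2\<^esub> \<otimes>\<^bsub>P2\<^esub> b) \<oplus>\<^bsub>T\<^esub> pure (\<one>\<^bsub>P1\<^esub> \<otimes>\<^bsub>P1\<^esub> a) (z2 \<otimes>\<^bsub>P2\<^esub> b)) \<ominus>\<^bsub>T\<^esub>
      (pure (a \<otimes>\<^bsub>P1\<^esub> z1) (b \<otimes>\<^bsub>P2\<^esub> \<one>\<^bsub>P2\<^esub>) \<oplus>\<^bsub>T\<^esub> pure (a \<otimes>\<^bsub>P1\<^esub> \<one>\<^bsub>P1\<^esub>) (b \<otimes>\<^bsub>P2\<^esub> z2))"
      unfolding br using nc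
      by (simp add: frag_bracket_def frag_mult_def frag_extend2_add_left frag_extend2_add_right
          frag_extend2_of pure_tensor_def d cls_add)
    moreover have "ad P1 z1 a = z1 \<otimes>\<^bsub>P1\<^esub> a \<ominus>\<^bsub>P1\<^esub> a \<otimes>\<^bsub>P1\<^esub> z1"
      "ad P2 z2 b = z2 \<otimes>\<^bsub>P2\<^esub> b \<ominus>\<^bsub>P2\<^esub> b \<otimes>\<^bsub>P2\<^esub> z2"
      using c2 z ab by (auto simp: class2_def ad_def)
    ultimately show ?thesis
      using z ab by (simp add: a_minus_def pure_add_left pure_add_right pure_uminus_left
          pure_uminus_right pure_closed T.M.minus_add T.M.a_ac)
  qed
qed

end

section \<open>Spectrum and nilpotency of \<Gamma>\<close>

lemma F_set_eq: "F_set K P z = locally_finite_part K P (ad P z)"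
  by (simp add: F_set_def locally_finite_part_def fin_dim_subspace_def)

lemma N_set_eq: "N_set P z = nil_part P (ad P z)"
  by (simp add: N_set_def nil_part_def)

theorem corollary6p6:
  fixes K :: "('k, 'm) ring_scheme"
    and P1 :: "('k, 'a, 'n1) poisson_scheme"
    and P2 :: "('k, 'b, 'n2) poisson_scheme"
    and u1 :: "'a \<Rightarrow> int extended"
    and u2 :: "'b \<Rightarrow> int extended"
    and z1 :: 'a and z2 :: 'b
    and T :: "('k, (('a \<times> 'b) \<Rightarrow>\<^sub>0 int) set) poisson"
    and \<Gamma> :: "(('a \<times> 'b) \<Rightarrow>\<^sub>0 int) set"
  assumes K_alg_closed: "algebraically_closed K"
    and K_char_zero: "\<And>n :: nat. n > 0 \<Longrightarrow> [n] \<cdot>\<^bsub>K\<^esub> \<one>\<^bsub>K\<^esub> \<noteq> \<zero>\<^bsub>K\<^esub>"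
    and P1: "nc_poisson_algebra K P1"
    and P2: "nc_poisson_algebra K P2"
    and same_class: "(class1 P1 \<and> class1 P2) \<or> (class2 P1 \<and> class2 P2)"
    and u1: "degree_map P1 u1"
    and u2: "degree_map P2 u2"
    and u1_range: "\<And>a. a \<in> carrier P1 \<Longrightarrow> u1 a = -\<infinity> \<or> (\<exists>d\<ge>0. u1 a = Fin d)"
    and u2_range: "\<And>a. a \<in> carrier P2 \<Longrightarrow> u2 a = -\<infinity> \<or> (\<exists>d\<ge>0. u2 a = Fin d)"
    and u1_finite: "finite_filtration K P1 u1"
    and u2_finite: "finite_filtration K P2 u2"
    and u1_discrete: "discrete_filtration P1 u1"
    and u2_discrete: "discrete_filtration P2 u2"
    and z1: "z1 \<in> carrier P1"
    and z2: "z2 \<in> carrier P2"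
    and F1: "F_set K P1 z1 = N_set P1 z1"
    and F2: "F_set K P2 z2 = N_set P2 z2"
    and T_def: "T = tensor_poisson K P1 P2"
    and \<Gamma>_def: "\<Gamma> = pure_tensor K P1 P2 z1 \<one>\<^bsub>P2\<^esub> \<oplus>\<^bsub>T\<^esub> pure_tensor K P1 P2 \<one>\<^bsub>P1\<^esub> z2"
  shows "F_set K T \<Gamma> = N_set T \<Gamma>
       \<and> N_set T \<Gamma> = tensor_subspaces K P1 P2 (N_set P1 z1) (N_set P2 z2)
       \<and> D_set K T \<Gamma> = C_set T \<Gamma>
       \<and> Ev K T \<Gamma> = {\<zero>\<^bsub>K\<^esub>}
       \<and> (C_set P1 z1 \<subset> N_set P1 z1 \<or> C_set P2 z2 \<subset> N_set P2 z2 \<longrightarrow>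
            D_set K T \<Gamma> = C_set T \<Gamma> \<and> C_set T \<Gamma> \<subset> N_set T \<Gamma> \<and> N_set T \<Gamma> = F_set K T \<Gamma>
            \<and> \<Gamma> \<in> Omega1 K T \<union> Omega1' K T \<and> \<Gamma> \<in> nilpotent_elements K T)"
proof -
  interpret PP: poisson_pair K P1 P2 using P1 P2 by (simp add: poisson_pair_def)
  let ?p = "pure_tensor K P1 P2"
  let ?f = "ad P1 z1" and ?g = "ad P2 z2" and ?d = "ad T \<Gamma>"
  interpret TP: tensor_pairing K P1 P2 T ?p unfolding T_def by (rule PP.T_pairing)
  have \<Gamma>: "\<Gamma> = PP.tensor_gamma z1 z2" by (simp add: \<Gamma>_def PP.tensor_gamma_def T_def)
  have \<Gamma>_closed: "\<Gamma> \<in> carrier T" using z1 z2 by (simp add: \<Gamma>_def TP.t_closed)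
  have f: "?f \<in> module_hom K P1 P1" and g: "?g \<in> module_hom K P2 P2"
    using PP.P1.bracket_hom[OF z1] PP.P2.bracket_hom[OF z2] by (auto simp: ad_def[abs_def])
  have f_closed: "?f a \<in> carrier P1" if "a \<in> carrier P1" for a using module_hom_closed[OF f] that by blast
  have g_closed: "?g a \<in> carrier P2" if "a \<in> carrier P2" for a using module_hom_closed[OF g] that by blast
  have d_pure: "?d (?p a b) = ?p (?f a) b \<oplus>\<^bsub>T\<^esub> ?p a (?g b)"
    if "a \<in> carrier P1" "b \<in> carrier P2" for a b
    unfolding \<Gamma> T_def by (rule PP.ad_gamma_pure[OF same_class z1 z2 that])
  have d_add: "?d (x \<oplus>\<^bsub>T\<^esub> y) = ?d x \<oplus>\<^bsub>T\<^esub> ?d y" if "x \<in> carrier T" "y \<in> carrier T" for x y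
    using PP.ad_gamma_add[OF z1 z2] that unfolding \<Gamma> T_def by blast
  \<comment> \<open>Additivity alone would not give this, as closure of \<open>?d\<close> is not yet
    available and its inductive proof needs the zero case. Writing zero as 0 \<otimes> 1 makes the
    formula for pure tensors applicable instead.\<close>
  have d_zero: "?d \<zero>\<^bsub>T\<^esub> = \<zero>\<^bsub>T\<^esub>"
  proof -
    have pz: "?p \<zero>\<^bsub>P1\<^esub> \<one>\<^bsub>P2\<^esub> = \<zero>\<^bsub>T\<^esub>" unfolding T_def by (rule PP.pure_zero_left) simp
    have "?d \<zero>\<^bsub>T\<^esub> = ?p (?f \<zero>\<^bsub>P1\<^esub>) \<one>\<^bsub>P2\<^esub> \<oplus>\<^bsub>T\<^esub> ?p \<zero>\<^bsub>P1\<^esub> (?g \<one>\<^bsub>P2\<^esub>)"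
      using d_pure[of "\<zero>\<^bsub>P1\<^esub>" "\<one>\<^bsub>P2\<^esub>"] pz by simp
    also have "?f \<zero>\<^bsub>P1\<^esub> = \<zero>\<^bsub>P1\<^esub>"
      by (rule module_hom_zero[OF PP.P1.module_axioms PP.P1.module_axioms f])
    also have "?p \<zero>\<^bsub>P1\<^esub> (?g \<one>\<^bsub>P2\<^esub>) = \<zero>\<^bsub>T\<^esub>"
      unfolding T_def by (rule PP.pure_zero_left) (simp add: g_closed)
    finally show ?thesis by (simp add: pz)
  qed
  have d_closed: "?d x \<in> carrier T" if "x \<in> carrier T" for x
    using that by (rule TP.t_induct) (simp_all add: d_zero d_pure d_add TP.t_closed f_closed g_closed)
  interpret TD: tensor_derivation K P1 P2 T ?p ?f ?g ?d
    by unfold_locales (simp_all add: f g d_closed d_add d_pure)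
  note d_hom = TD.d_hom

  have N: "F_set K T \<Gamma> = N_set T \<Gamma>"
    "N_set T \<Gamma> = tensor_subspaces K P1 P2 (N_set P1 z1) (N_set P2 z2)"
    using TD.locally_finite_part_eq F1 F2
    by (simp_all add: F_set_eq N_set_eq tensor_subspaces_def T_def)

  have one1: "?f \<one>\<^bsub>P1\<^esub> = \<zero>\<^bsub>P1\<^esub>" and one2: "?g \<one>\<^bsub>P2\<^esub> = \<zero>\<^bsub>P2\<^esub>"
    by (simp_all add: ad_def PP.P1.bracket_one_right PP.P2.bracket_one_right z1 z2)
  have zero1: "?p \<zero>\<^bsub>P1\<^esub> b = \<zero>\<^bsub>T\<^esub>" if "b \<in> carrier P2" for b
    unfolding T_def by (rule PP.pure_zero_left[OF that])
  have zero2: "?p a \<zero>\<^bsub>P2\<^esub> = \<zero>\<^bsub>T\<^esub>" if "a \<in> carrier P1" for a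
    unfolding T_def by (rule PP.pure_zero_right[OF that])
  have d_left: "?d (?p a \<one>\<^bsub>P2\<^esub>) = ?p (?f a) \<one>\<^bsub>P2\<^esub>" if "a \<in> carrier P1" for a
    using that by (simp add: d_pure one2 zero2 TP.t_closed f_closed)
  have d_right: "?d (?p \<one>\<^bsub>P1\<^esub> b) = ?p \<one>\<^bsub>P1\<^esub> (?g b)" if "b \<in> carrier P2" for b
    using that by (simp add: d_pure one1 zero1 TP.t_closed g_closed)

  have Ev: "Ev K T \<Gamma> = {\<zero>\<^bsub>K\<^esub>}"
  proof (intro equalityI subsetI)
    fix c assume "c \<in> Ev K T \<Gamma>"
    then obtain x where c: "c \<in> carrier K" and x: "x \<in> carrier T" "x \<noteq> \<zero>\<^bsub>T\<^esub>" "?d x = c \<odot>\<^bsub>T\<^esub> x"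
      by (auto simp: Ev_def)
    \<comment> \<open>An eigenvector spans a stable line, so it lies in F(\<Gamma>), which is
      N(\<Gamma>); nilpotency then forces the eigenvalue to be zero.\<close>
    have "(?d ^^ n) x \<in> TP.T.span {x}" for n
    proof (induction n)
      case 0
      then show ?case using TP.T.in_own_span[of "{x}"] x by simp
    next
      case (Suc n)
      have "(?d ^^ Suc n) x = c \<odot>\<^bsub>T\<^esub> (?d ^^ n) x"
        using module_hom_smult[OF module_hom_funpow[OF d_hom] c x(1), of n]
        by (simp only: funpow_Suc_right o_apply x(3))
      then show ?case
        using submodule.smult_closed[OF TP.T.span_is_submodule c Suc] x by simp
    qed
    then have "x \<in> locally_finite_part K T ?d"
      using x by (intro TP.T.locally_finite_partI[OF d_hom x(1), of "{x}"]) auto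
    then have "x \<in> nil_part T ?d" using N(1) by (simp add: F_set_eq N_set_eq)
    then show "c \<in> {\<zero>\<^bsub>K\<^esub>}" using TP.T.eigenvalue_nilpotent[OF d_hom c _ x(2,3)] by simp
  next
    fix c assume "c \<in> {\<zero>\<^bsub>K\<^esub>}"
    \<comment> \<open>Zero is attained at 1 \<otimes> 1, which is nonzero and is killed because both
      adjoint maps kill the unit.\<close>
    moreover have "?p \<one>\<^bsub>P1\<^esub> \<one>\<^bsub>P2\<^esub> \<in> carrier T - {\<zero>\<^bsub>T\<^esub>}"
      by (simp add: TP.t_closed TP.t_nonzero PP.P1.P_one_not_zero PP.P2.P_one_not_zero)
    moreover have "?d (?p \<one>\<^bsub>P1\<^esub> \<one>\<^bsub>P2\<^esub>) = \<zero>\<^bsub>K\<^esub> \<odot>\<^bsub>T\<^esub> ?p \<one>\<^bsub>P1\<^esub> \<one>\<^bsub>P2\<^esub>"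
      by (simp add: d_left one1 zero1 TP.t_closed)
    ultimately show "c \<in> Ev K T \<Gamma>" unfolding Ev_def by auto
  qed

  have C_sub: "submodule K (C_set T \<Gamma>) T"
    using d_zero by (intro submodule.intro TP.T.module_axioms)
      (auto simp: C_set_def d_add module_hom_smult[OF d_hom])
  \<comment> \<open>Zero being the only eigenvalue, the direct sum of eigenspaces reduces to the
    kernel of \<open>?d\<close>, which is a subspace and equals its own span.\<close>
  have "{x \<in> carrier T. ?d x = \<zero>\<^bsub>K\<^esub> \<odot>\<^bsub>T\<^esub> x} = C_set T \<Gamma>"
    unfolding C_set_def by (intro Collect_cong conj_cong refl) (simp only: TP.T.lmult_0)
  then have "(\<Union>c\<in>Ev K T \<Gamma>. {x \<in> carrier T. ?d x = c \<odot>\<^bsub>T\<^esub> x}) = C_set T \<Gamma>"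
    by (simp only: Ev UN_insert UN_empty Un_empty_right)
  moreover have "TP.T.span (C_set T \<Gamma>) = C_set T \<Gamma>"
    using TP.T.span_is_subset[OF subset_refl C_sub] TP.T.in_own_span[of "C_set T \<Gamma>"]
    by (auto simp: C_set_def)
  ultimately have D: "D_set K T \<Gamma> = C_set T \<Gamma>" by (simp add: D_set_def)

  have CN: "C_set T \<Gamma> \<subset> N_set T \<Gamma>" if "C_set P1 z1 \<subset> N_set P1 z1 \<or> C_set P2 z2 \<subset> N_set P2 z2"
  proof -
    have "C_set T \<Gamma> \<subseteq> N_set T \<Gamma>" by (auto simp: C_set_def N_set_def intro: exI[of _ 1])
    moreover have "\<exists>x. x \<in> N_set T \<Gamma> - C_set T \<Gamma>"
      using that
    proof
      assume "C_set P1 z1 \<subset> N_set P1 z1"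
      then obtain a where "a \<in> N_set P1 z1" "a \<notin> C_set P1 z1" by blast
      then obtain m where a: "a \<in> carrier P1" "(?f ^^ m) a = \<zero>\<^bsub>P1\<^esub>" "?f a \<noteq> \<zero>\<^bsub>P1\<^esub>"
        by (auto simp: N_set_def C_set_def)
      \<comment> \<open>\<open>a\<close> is killed by the power \<open>m\<close> and the unit by the
        first power, while \<open>?d\<close> maps a \<otimes> 1 to the nonzero pure tensor f(a)
        \<otimes> 1.\<close>
      have "?p a \<one>\<^bsub>P2\<^esub> \<in> nil_part T ?d"
        by (rule TD.pure_nilpotent[of _ _ m 1]) (simp_all add: a one2)
      moreover have "?d (?p a \<one>\<^bsub>P2\<^esub>) \<noteq> \<zero>\<^bsub>T\<^esub>"
        using a by (simp add: d_left TP.t_nonzero f_closed PP.P2.P_one_not_zero)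
      ultimately show ?thesis by (auto simp: N_set_eq C_set_def)
    next
      assume "C_set P2 z2 \<subset> N_set P2 z2"
      then obtain b where "b \<in> N_set P2 z2" "b \<notin> C_set P2 z2" by blast
      then obtain m where b: "b \<in> carrier P2" "(?g ^^ m) b = \<zero>\<^bsub>P2\<^esub>" "?g b \<noteq> \<zero>\<^bsub>P2\<^esub>"
        by (auto simp: N_set_def C_set_def)
      have "?p \<one>\<^bsub>P1\<^esub> b \<in> nil_part T ?d"
        by (rule TD.pure_nilpotent[of _ _ 1 m]) (simp_all add: b one1)
      moreover have "?d (?p \<one>\<^bsub>P1\<^esub> b) \<noteq> \<zero>\<^bsub>T\<^esub>"
        using b by (simp add: d_right TP.t_nonzero g_closed PP.P1.P_one_not_zero)
      ultimately show ?thesis by (auto simp: N_set_eq C_set_def)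
    qed
    ultimately show ?thesis by blast
  qed
  have "N_set T \<Gamma> \<subseteq> carrier T" by (auto simp: N_set_def)
  \<comment> \<open>Whether N(\<Gamma>) is all of \<open>T\<close> is left open; the two
    alternatives are the two kinds of nilpotent elements.\<close>
  then have "\<Gamma> \<in> Omega1 K T \<union> Omega1' K T"
    if "C_set P1 z1 \<subset> N_set P1 z1 \<or> C_set P2 z2 \<subset> N_set P2 z2"
    using CN[OF that] Ev \<Gamma>_closed by (auto simp: Omega1_def Omega1'_def)
  then show ?thesis using N D Ev CN unfolding nilpotent_elements_def by metis
qed

end
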